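(* Up to isomorphism, there are exactly five connected simple planar graphs that are 2-line existentially closed. They are the following five graphs on the vertex set $\{1,2,3,4,5,6,7\}$, where $ij$ denotes the edge $\{i,j\}$: (1) $G_1$ (named Tc20), with edge set $\{12,13,14,23,25,27,36,37,45,46,57,67\}$; (2) $G_2$ (named Tc30), with edge set $E(G_1)\cup\{56\}$; (3) $G_3$ (named Tc39), with edge set $E(G_1)\cup\{15,16\}$; (4) $G_4$ (named Tc43), with edge set $E(G_1)\cup\{15,16,56\}$; (5) $G_5$ (named Tc44, the graph of the pentagonal bipyramid), with edge set $E(G_1)\cup\{15,16,47\}$.
   Context: Two distinct edges of a graph are adjacent if they share at least one end vertex. A graph with at least two edges is 2-line existentially closed (2-line e.c.) if, for all disjoint sets of edges $A$ and $B$ with $|A\cup B|=2$ (either may be empty), there is an edge $e\notin A\cup B$ that is adjacent to each edge of $A$ and to no edge of $B$. Equivalently, the line graph of $G$ is 2-existentially closed. *)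

theory Defs
  imports "HOL-Analysis.Analysis"
begin

text \<open>A graph is a pair of a vertex set and a set of edges, an edge being the set of its end vertices.\<close>

type_synonym 'a ugraph = "'a set \<times> 'a set set"

abbreviation verts :: "'a ugraph \<Rightarrow> 'a set" where
  "verts G \<equiv> fst G"

abbreviation edges :: "'a ugraph \<Rightarrow> 'a set set" where
  "edges G \<equiv> snd G"

definition simple_graph :: "'a ugraph \<Rightarrow> bool" where
  "simple_graph G \<longleftrightarrow> finite (verts G) \<and> (\<forall>e\<in>edges G. e \<subseteq> verts G \<and> card e = 2)"

definition connected_graph :: "'a ugraph \<Rightarrow> bool" where
  "connected_graph G \<longleftrightarrow> verts G \<noteq> {} \<and>
     (\<forall>u\<in>verts G. \<forall>v\<in>verts G. (u, v) \<in> {(x, y). {x, y} \<in> edges G}\<^sup>*)"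

definition graph_iso :: "'a ugraph \<Rightarrow> 'b ugraph \<Rightarrow> bool" where
  "graph_iso G H \<longleftrightarrow> (\<exists>f. bij_betw f (verts G) (verts H) \<and>
     (\<forall>u\<in>verts G. \<forall>v\<in>verts G. {u, v} \<in> edges G \<longleftrightarrow> {f u, f v} \<in> edges H))"

text \<open>
  Planarity is topological: \<open>p\<close> and \<open>\<gamma>\<close> form a drawing of the graph in the Euclidean plane,
  identified with the complex numbers as in the library's Jordan curve theorem. Vertices are
  drawn as distinct points and edges as arcs joining their end vertices; an arc contains no
  other vertex, and two arcs meet only in common end vertices.
\<close>

definition planar_drawing ::
    "'a ugraph \<Rightarrow> ('a \<Rightarrow> complex) \<Rightarrow> ('a set \<Rightarrow> real \<Rightarrow> complex) \<Rightarrow> bool" where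
  "planar_drawing G p \<gamma> \<longleftrightarrow>
     inj_on p (verts G) \<and>
     (\<forall>e\<in>edges G. arc (\<gamma> e) \<and> {pathstart (\<gamma> e), pathfinish (\<gamma> e)} = p ` e \<and>
        path_image (\<gamma> e) \<inter> p ` verts G = p ` e) \<and>
     (\<forall>e\<in>edges G. \<forall>f\<in>edges G. e \<noteq> f \<longrightarrow>
        path_image (\<gamma> e) \<inter> path_image (\<gamma> f) = p ` (e \<inter> f))"

definition planar_graph :: "'a ugraph \<Rightarrow> bool" where
  "planar_graph G \<longleftrightarrow> (\<exists>p \<gamma>. planar_drawing G p \<gamma>)"

definition adjacent_edges :: "'a set \<Rightarrow> 'a set \<Rightarrow> bool" where
  "adjacent_edges e f \<longleftrightarrow> e \<noteq> f \<and> e \<inter> f \<noteq> {}"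

definition two_line_ec :: "'a ugraph \<Rightarrow> bool" where
  "two_line_ec G \<longleftrightarrow> card (edges G) \<ge> 2 \<and>
     (\<forall>A B. A \<subseteq> edges G \<and> B \<subseteq> edges G \<and> A \<inter> B = {} \<and> card (A \<union> B) = 2 \<longrightarrow>
        (\<exists>e\<in>edges G. e \<notin> A \<union> B \<and>
           (\<forall>a\<in>A. adjacent_edges e a) \<and> (\<forall>b\<in>B. \<not> adjacent_edges e b)))"

definition Tc20 :: "nat ugraph" where
  "Tc20 = ({1, 2, 3, 4, 5, 6, 7},
     {{1,2}, {1,3}, {1,4}, {2,3}, {2,5}, {2,7}, {3,6}, {3,7}, {4,5}, {4,6}, {5,7}, {6,7}})"

definition Tc30 :: "nat ugraph" where
  "Tc30 = (verts Tc20, edges Tc20 \<union> {{5,6}})"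

definition Tc39 :: "nat ugraph" where
  "Tc39 = (verts Tc20, edges Tc20 \<union> {{1,5}, {1,6}})"

definition Tc43 :: "nat ugraph" where
  "Tc43 = (verts Tc20, edges Tc20 \<union> {{1,5}, {1,6}, {5,6}})"

definition Tc44 :: "nat ugraph" where
  "Tc44 = (verts Tc20, edges Tc20 \<union> {{1,5}, {1,6}, {4,7}})"

definition Tc_graphs :: "nat ugraph list" where
  "Tc_graphs = [Tc20, Tc30, Tc39, Tc43, Tc44]"

end

theory Submission
  imports Defs
begin

text \<open>
  A connected graph is 2-line e.c. only if it has minimum degree at least 3, has no induced \<open>2K2\<close>, and no
  two of its edges cover all edges. A planar graph contains no \<open>K33\<close>, not even with one edge subdivided,
  by the Jordan curve theorem and Janiszewski's theorem. These properties suffice. Grow an induced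
  subgraph from a single vertex: if a vertex has degree at most 2 in it, add a further neighbour of that
  vertex; if two edges cover all edges, add any vertex adjacent to the subgraph. The excluded
  configurations leave few extensions at each stage, and up to isomorphism about seventy induced
  subgraphs, with at most nine vertices, need to be considered. Only the five listed graphs can be the
  whole graph.
\<close>

section \<open>Nonplanarity of \<open>K33\<close>\<close>

text \<open>Being 2-line e.c. does not pass to induced subgraphs, so the conditions used are of two
  kinds. Absence of an induced \<open>2K2\<close>, of \<open>K33\<close> and of its subdivision
  holds in every induced subgraph, so a subgraph violating it can be discarded even while some
  adjacencies of its last vertex are open. The degree and covering conditions concern the whole
  graph: their failure in \<open>H\<close> only shows that \<open>G\<close> has a vertex outside
  \<open>H\<close>. Even one of the five graphs has to be extended, since \<open>G\<close> might
  contain it properly. The order of \<open>G\<close> is not bounded beforehand. Instead the growth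
  is read backwards: \<open>H\<close> is settled once every extension by one vertex is contradictory
  or contains an induced copy of a graph settled earlier. The last graph to be settled is the single
  vertex, which lies in every \<open>G\<close>.\<close>

lemma connected_subset_open_disjoint:
  assumes "connected S" "open U" "open V" "U \<inter> V = {}" "S \<subseteq> U \<union> V"
  shows "S \<subseteq> U \<or> S \<subseteq> V"
  using connectedD[OF assms(1-3)] assms(4,5) by blast

text \<open>Arcs are kept as point sets with two ends: the crossing argument uses only connectedness
  and intersections, and the direction can be reversed at will.\<close>

definition arc_between :: "complex set \<Rightarrow> complex \<Rightarrow> complex \<Rightarrow> bool" where
  "arc_between S a b \<longleftrightarrow> (\<exists>g. arc g \<and> path_image g = S \<and> pathstart g = a \<and> pathfinish g = b)"

lemma arc_between_sym: "arc_between S a b \<Longrightarrow> arc_between S b a"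
  unfolding arc_between_def
  by (metis arc_reversepath path_image_reversepath pathfinish_reversepath pathstart_reversepath)

lemma arc_between_join:
  assumes "arc_between S a b" "arc_between T b c" "S \<inter> T = {b}"
  shows "arc_between (S \<union> T) a c"
proof -
  obtain g h where g: "arc g" "path_image g = S" "pathstart g = a" "pathfinish g = b"
    and h: "arc h" "path_image h = T" "pathstart h = b" "pathfinish h = c"
    using assms unfolding arc_between_def by blast
  have "arc (g +++ h)"
    using g h assms(3) by (intro arc_join) auto
  moreover have "path_image (g +++ h) = S \<union> T"
    using g h by (simp add: path_image_join)
  ultimately show ?thesis
    unfolding arc_between_def using g h by (intro exI[of _ "g +++ h"]) auto
qed

lemma arc_between_ends: "arc_between S a b \<Longrightarrow> a \<in> S \<and> b \<in> S \<and> a \<noteq> b"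
  unfolding arc_between_def by (metis arc_distinct_ends pathfinish_in_path_image pathstart_in_path_image)

lemma arc_between_compact: "arc_between S a b \<Longrightarrow> compact S"
  unfolding arc_between_def using compact_arc_image by blast

lemma arc_between_connected: "arc_between S a b \<Longrightarrow> connected S"
  unfolding arc_between_def using connected_arc_image by blast

text \<open>The inclusion in the closure allows an end to be added to the open arc without losing
  connectedness; pieces are later joined through such an end.\<close>

lemma arc_between_interior:
  assumes "arc_between S a b"
  shows "connected (S - {a,b})" "S - {a,b} \<noteq> {}" "S \<subseteq> closure (S - {a,b})"
proof -
  obtain g where g: "arc g" "path_image g = S" "pathstart g = a" "pathfinish g = b"
    using assms unfolding arc_between_def by blast
  then show "connected (S - {a,b})" "S - {a,b} \<noteq> {}"
    using connected_simple_path_endless nonempty_simple_path_endless arc_imp_simple_path by blast+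
  have "S - {a,b} = g ` {0<..<1}"
    using simple_path_endless g arc_imp_simple_path by blast
  moreover have "g ` closure {0<..<1} \<subseteq> closure (g ` {0<..<1})"
    using arc_imp_path[OF g(1)] by (intro image_closure_subset) (simp_all add: path_def closure_subset)
  moreover have "g ` closure {0<..<1} = S"
    using g(2) by (simp add: path_image_def)
  ultimately show "S \<subseteq> closure (S - {a,b})"
    by simp
qed

section \<open>Jordan curves made of two arcs, and their chords\<close>

lemma Jordan_inside_outside_arcs:
  assumes "arc_between C1 a b" "arc_between C2 a b" "C1 \<inter> C2 = {a,b}"
  defines "J \<equiv> C1 \<union> C2"
  shows "open (inside J)" "connected (inside J)" "inside J \<noteq> {}" "open (outside J)" "connected (outside J)"
    "outside J \<noteq> {}" "frontier (inside J) = J" "frontier (outside J) = J"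
proof -
  obtain g h where g: "arc g" "path_image g = C1" "pathstart g = a" "pathfinish g = b"
    and h: "arc h" "path_image h = C2" "pathstart h = b" "pathfinish h = a"
    using assms(1) arc_between_sym[OF assms(2)] unfolding arc_between_def by blast
  have "simple_path (g +++ h)" "pathfinish (g +++ h) = pathstart (g +++ h)" "path_image (g +++ h) = J"
    using g h assms(3) by (auto simp: simple_path_join_loop_eq path_image_join J_def)
  with Jordan_inside_outside[of "g +++ h"]
  show "open (inside J)" "connected (inside J)" "inside J \<noteq> {}" "open (outside J)" "connected (outside J)"
    "outside J \<noteq> {}" "frontier (inside J) = J" "frontier (outside J) = J" by auto
qed

text \<open>The open arc is connected and misses the curve, so it cannot meet both of the disjoint
  open sets that make up the complement.\<close>

lemma arc_inside_or_outside:
  assumes "arc_between C1 a b" "arc_between C2 a b" "C1 \<inter> C2 = {a,b}"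
    and "arc_between D x y" "D \<inter> (C1 \<union> C2) = {x,y}"
  shows "D - {x,y} \<subseteq> inside (C1 \<union> C2) \<or> D - {x,y} \<subseteq> outside (C1 \<union> C2)"
proof -
  note J = Jordan_inside_outside_arcs[OF assms(1-3)]
  have "D - {x,y} \<subseteq> inside (C1 \<union> C2) \<union> outside (C1 \<union> C2)"
    unfolding inside_Un_outside using assms(5) by blast
  then show ?thesis
    using connected_subset_open_disjoint[OF arc_between_interior(1)[OF assms(4)] J(1,4)] inside_Int_outside
    by metis
qed

text \<open>
  The domain \<open>V\<close> on the other side of the closed curve reaches \<open>x\<close> and \<open>y\<close>, so it is joined to
  the arc \<open>D\<close> both off \<open>C1 \<union> C\<close> (through \<open>y\<close>) and off \<open>C2 \<union> C\<close> (through \<open>x\<close>). By Janiszewski's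
  theorem it is joined to \<open>D\<close> off the union of the three arcs.
\<close>

lemma crossing_chords:
  assumes C1: "arc_between C1 a b" and C2: "arc_between C2 a b" and C: "arc_between C a b"
    and D: "arc_between D x y"
    and C12: "C1 \<inter> C2 = {a,b}" and CJ: "C \<inter> (C1 \<union> C2) = {a,b}" and DJ: "D \<inter> (C1 \<union> C2) = {x,y}"
    and CD: "C \<inter> D = {}" and x: "x \<in> C1" and y: "y \<in> C2"
    and U: "open U" "C - {a,b} \<subseteq> U" "D - {x,y} \<subseteq> U"
    and V: "open V" "connected V" "V \<noteq> {}" "frontier V = C1 \<union> C2"
    and UV: "U \<inter> V = {}" "U \<union> V = - (C1 \<union> C2)"
  shows False
proof -
  have xyD: "{x,y} \<subseteq> D"
    using arc_between_ends[OF D] by simp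
  \<comment> \<open>\<open>C1\<close> and \<open>C2\<close> meet only in \<open>a\<close> and
    \<open>b\<close>, which lie on \<open>C\<close>. As \<open>D\<close> avoids \<open>C\<close>, no
    end of \<open>D\<close> is on both arcs.\<close>
  have xy: "x \<notin> C2" "y \<notin> C1" "x \<noteq> y"
  proof -
    have "{a,b} \<subseteq> C"
      using arc_between_ends[OF C] by simp
    with xyD have "{x,y} \<inter> (C1 \<inter> C2) = {}"
      unfolding C12 using CD by blast
    then show "x \<notin> C2" "y \<notin> C1"
      using x y by auto
    show "x \<noteq> y"
      using arc_between_ends[OF D] by blast
  qed
  obtain m where m: "m \<in> D - {x,y}"
    using arc_between_interior(2)[OF D] by blast
  obtain v where v: "v \<in> V"
    using V by blast
  have VC: "V \<inter> C1 = {}" "V \<inter> C2 = {}" "V \<inter> C = {}"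
  proof -
    show V12: "V \<inter> C1 = {}" "V \<inter> C2 = {}"
      using Un_upper2[of V U] unfolding UV(2) by auto
    have "{a,b} \<subseteq> C1"
      using arc_between_ends[OF C1] by simp
    show "V \<inter> C = {}"
    proof (rule equals0I)
      fix z assume "z \<in> V \<inter> C"
      moreover from this have "z \<notin> {a,b}"
        using V12(1) \<open>{a,b} \<subseteq> C1\<close> by blast
      ultimately have "z \<in> U \<inter> V"
        using U(2) by blast
      then show False
        unfolding UV(1) by simp
    qed
  qed
  \<comment> \<open>Used with \<open>T = C1 \<union> C\<close>, \<open>z = y\<close> and with
    \<open>T = C2 \<union> C\<close>, \<open>z = x\<close>. Both the open arc and \<open>V\<close>
    have \<open>z\<close> as a limit point, so each stays connected when \<open>z\<close> is added,
    and they then share \<open>z\<close>.\<close>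
  have join: "connected_component (- T) m v"
    if "z = x \<or> z = y" "V \<inter> T = {}" "(D - {x,y}) \<inter> T = {}" "z \<notin> T" for z T
  proof -
    have "insert z (D - {x,y}) \<subseteq> D"
      using that(1) xyD by blast
    then have "insert z (D - {x,y}) \<subseteq> closure (D - {x,y})"
      using arc_between_interior(3)[OF D] by (rule order_trans)
    then have "connected (insert z (D - {x,y}))"
      using connected_intermediate_closure[OF arc_between_interior(1)[OF D]] by blast
    moreover have "z \<in> frontier V"
      unfolding V(4) using that(1) x y by blast
    then have "insert z V \<subseteq> closure V"
      using closure_subset[of V] by (simp add: frontier_def)
    then have "connected (insert z V)"
      using connected_intermediate_closure[OF V(2)] by blast
    ultimately have "connected (insert z (D - {x,y}) \<union> insert z V)"
      by (intro connected_Un) auto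
    moreover have "insert z (D - {x,y}) \<union> insert z V \<subseteq> - T"
      using that by blast
    ultimately show ?thesis
      unfolding connected_component_def using m v by blast
  qed
  have "connected_component (- ((C1 \<union> C) \<union> (C2 \<union> C))) m v"
  proof (rule Janiszewski)
    show "compact (C1 \<union> C)" "closed (C2 \<union> C)"
      using C1 C2 C by (simp_all add: arc_between_compact compact_Un compact_imp_closed closed_Un)
    \<comment> \<open>Janiszewski's theorem asks for a connected intersection; it is the arc
      \<open>C\<close>, because \<open>C\<close> contains the common points \<open>a\<close> and
      \<open>b\<close> of \<open>C1\<close> and \<open>C2\<close>.\<close>
    have "(C1 \<union> C) \<inter> (C2 \<union> C) = C"
      using C12 CJ by blast
    then show "connected ((C1 \<union> C) \<inter> (C2 \<union> C))"
      using arc_between_connected[OF C] by simp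
    show "connected_component (- (C1 \<union> C)) m v"
    proof (rule join)
      show "V \<inter> (C1 \<union> C) = {}"
        using VC by auto
      show "(D - {x,y}) \<inter> (C1 \<union> C) = {}"
        using DJ CD by auto
      show "y \<notin> C1 \<union> C"
        using xy xyD CD by auto
    qed simp
    show "connected_component (- (C2 \<union> C)) m v"
    proof (rule join)
      show "V \<inter> (C2 \<union> C) = {}"
        using VC by auto
      show "(D - {x,y}) \<inter> (C2 \<union> C) = {}"
        using DJ CD by auto
      show "x \<notin> C2 \<union> C"
        using xy xyD CD by auto
    qed simp
  qed
  \<comment> \<open>A connected set off the three arcs lies in \<open>U \<union> V\<close>, but this
    one contains \<open>m\<close> from \<open>U\<close> and \<open>v\<close> from
    \<open>V\<close>.\<close>
  then have "connected_component (U \<union> V) m v"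
    unfolding UV(2) by (rule connected_component_of_subset) auto
  then obtain K where "connected K" "K \<subseteq> U \<union> V" "m \<in> K" "v \<in> K"
    by (auto simp: connected_component_def)
  then have "K \<subseteq> U \<or> K \<subseteq> V"
    using U(1) V(1) UV(1) by (intro connected_subset_open_disjoint)
  moreover have "m \<in> U"
    using m U(3) by blast
  ultimately have "m \<in> U \<inter> V \<or> v \<in> U \<inter> V"
    using v \<open>m \<in> K\<close> \<open>v \<in> K\<close> by blast
  then show False
    unfolding UV(1) by simp
qed

text \<open>The two sides of the curve are interchangeable: the one without the chords serves as the
  domain \<open>V\<close> of the crossing argument.\<close>

lemma crossing_chords_same_side:
  assumes "arc_between C1 a b" "arc_between C2 a b" "arc_between C a b" "arc_between D x y"
    and "C1 \<inter> C2 = {a,b}" "C \<inter> (C1 \<union> C2) = {a,b}" "D \<inter> (C1 \<union> C2) = {x,y}"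
    and "C \<inter> D = {}" "x \<in> C1" "y \<in> C2"
  shows "\<not> (C - {a,b} \<subseteq> inside (C1 \<union> C2) \<and> D - {x,y} \<subseteq> inside (C1 \<union> C2))"
    "\<not> (C - {a,b} \<subseteq> outside (C1 \<union> C2) \<and> D - {x,y} \<subseteq> outside (C1 \<union> C2))"
proof -
  note J = Jordan_inside_outside_arcs[OF assms(1,2,5)]
  show "\<not> (C - {a,b} \<subseteq> inside (C1 \<union> C2) \<and> D - {x,y} \<subseteq> inside (C1 \<union> C2))"
    using crossing_chords[OF assms J(1) _ _ J(4,5,6,8) inside_Int_outside inside_Un_outside] by metis
  show "\<not> (C - {a,b} \<subseteq> outside (C1 \<union> C2) \<and> D - {x,y} \<subseteq> outside (C1 \<union> C2))"
    using crossing_chords[OF assms J(4) _ _ J(1,2,3,7) trans[OF Int_commute inside_Int_outside]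
        trans[OF Un_commute inside_Un_outside]] by metis
qed

text \<open>
  The chord joining \<open>A i\<close> to \<open>B j\<close> and the chord joining \<open>A j\<close> to \<open>B k\<close> cross in the hexagon
  \<open>A i, B i, A j, B j, A k, B k\<close>.
\<close>

lemma K33_hexagon_chords:
  fixes A B :: "nat \<Rightarrow> complex" and S :: "nat \<Rightarrow> nat \<Rightarrow> complex set"
  assumes arc: "\<And>i j. i < 3 \<Longrightarrow> j < 3 \<Longrightarrow> arc_between (S i j) (A i) (B j)"
    and A: "\<And>i j l. \<lbrakk>i < 3; j < 3; l < 3; j \<noteq> l\<rbrakk> \<Longrightarrow> S i j \<inter> S i l = {A i}"
    and B: "\<And>i j k. \<lbrakk>i < 3; j < 3; k < 3; i \<noteq> k\<rbrakk> \<Longrightarrow> S i j \<inter> S k j = {B j}"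
    and disj: "\<And>i j k l. \<lbrakk>i < 3; j < 3; k < 3; l < 3; i \<noteq> k; j \<noteq> l\<rbrakk> \<Longrightarrow> S i j \<inter> S k l = {}"
    and ijk: "i < 3" "j < 3" "k < 3" "i \<noteq> j" "j \<noteq> k" "i \<noteq> k"
    and J: "J = (S i i \<union> S j i \<union> S j j) \<union> (S i k \<union> S k k \<union> S k j)"
  shows "S i j - {A i, B j} \<subseteq> inside J \<or> S i j - {A i, B j} \<subseteq> outside J"
    "\<not> (S i j - {A i, B j} \<subseteq> inside J \<and> S j k - {A j, B k} \<subseteq> inside J)"
    "\<not> (S i j - {A i, B j} \<subseteq> outside J \<and> S j k - {A j, B k} \<subseteq> outside J)"
proof -
  note inter = A B disj
  have path: "arc_between (S p r \<union> S q r \<union> S q s) (A p) (B s)"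
    if "p < 3" "q < 3" "r < 3" "s < 3" "p \<noteq> q" "r \<noteq> s" for p q r s
    using that by (intro arc_between_join[OF _ arc] arc_between_join[OF arc arc_between_sym[OF arc]])
      (auto simp: Int_Un_distrib2 inter)
  have C1: "arc_between (S i i \<union> S j i \<union> S j j) (A i) (B j)"
    using ijk by (intro path) auto
  have C2: "arc_between (S i k \<union> S k k \<union> S k j) (A i) (B j)"
    using ijk by (intro path) auto
  have 12: "(S i i \<union> S j i \<union> S j j) \<inter> (S i k \<union> S k k \<union> S k j) = {A i, B j}"
    using ijk by (auto simp: Int_Un_distrib Int_Un_distrib2 inter)
  have C: "S i j \<inter> ((S i i \<union> S j i \<union> S j j) \<union> (S i k \<union> S k k \<union> S k j)) = {A i, B j}"
    using ijk by (auto simp: Int_Un_distrib inter)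
  have D: "S j k \<inter> ((S i i \<union> S j i \<union> S j j) \<union> (S i k \<union> S k k \<union> S k j)) = {A j, B k}"
    using ijk by (auto simp: Int_Un_distrib inter)
  show "S i j - {A i, B j} \<subseteq> inside J \<or> S i j - {A i, B j} \<subseteq> outside J"
    unfolding J using ijk by (intro arc_inside_or_outside[OF C1 C2 12 _ C] arc)
  have "A j \<in> S i i \<union> S j i \<union> S j j" "B k \<in> S i k \<union> S k k \<union> S k j"
    using ijk arc_between_ends arc by blast+
  then show "\<not> (S i j - {A i, B j} \<subseteq> inside J \<and> S j k - {A j, B k} \<subseteq> inside J)"
    "\<not> (S i j - {A i, B j} \<subseteq> outside J \<and> S j k - {A j, B k} \<subseteq> outside J)"
    unfolding J using ijk
    by (intro crossing_chords_same_side[OF C1 C2 _ _ 12 C D] arc disj; simp)+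
qed

text \<open>Six of the nine arcs form a hexagon, and the remaining ones, \<open>S 0 1\<close>,
  \<open>S 1 2\<close> and \<open>S 2 0\<close>, are its long chords. Any two of these cross, so
  they would need different sides of the hexagon, but there are three chords and only two
  sides.\<close>

lemma K33_not_planar:
  fixes A B :: "nat \<Rightarrow> complex" and S :: "nat \<Rightarrow> nat \<Rightarrow> complex set"
  assumes arc: "\<And>i j. i < 3 \<Longrightarrow> j < 3 \<Longrightarrow> arc_between (S i j) (A i) (B j)"
    and A: "\<And>i j l. \<lbrakk>i < 3; j < 3; l < 3; j \<noteq> l\<rbrakk> \<Longrightarrow> S i j \<inter> S i l = {A i}"
    and B: "\<And>i j k. \<lbrakk>i < 3; j < 3; k < 3; i \<noteq> k\<rbrakk> \<Longrightarrow> S i j \<inter> S k j = {B j}"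
    and disj: "\<And>i j k l. \<lbrakk>i < 3; j < 3; k < 3; l < 3; i \<noteq> k; j \<noteq> l\<rbrakk> \<Longrightarrow> S i j \<inter> S k l = {}"
  shows False
proof -
  define J where "J = (S 0 0 \<union> S 1 0 \<union> S 1 1) \<union> (S 0 2 \<union> S 2 2 \<union> S 2 1)"
  \<comment> \<open>Rotating the indices 0, 1, 2 cyclically maps the hexagon to itself, so the chord
    lemma speaks of the same \<open>J\<close> for all three chords.\<close>
  have J': "J = (S 1 1 \<union> S 2 1 \<union> S 2 2) \<union> (S 1 0 \<union> S 0 0 \<union> S 0 2)"
    "J = (S 2 2 \<union> S 0 2 \<union> S 0 0) \<union> (S 2 1 \<union> S 1 1 \<union> S 1 0)"
    unfolding J_def by (simp_all add: Un_ac)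
  have chords: "S i j - {A i, B j} \<subseteq> inside J \<or> S i j - {A i, B j} \<subseteq> outside J"
    "\<not> (S i j - {A i, B j} \<subseteq> inside J \<and> S j k - {A j, B k} \<subseteq> inside J)"
    "\<not> (S i j - {A i, B j} \<subseteq> outside J \<and> S j k - {A j, B k} \<subseteq> outside J)"
    if "(i, j, k) \<in> {(0, 1, 2), (1, 2, 0), (2, 0, 1)}" for i j k
  proof -
    from that have ijk: "i < 3" "j < 3" "k < 3" "i \<noteq> j" "j \<noteq> k" "i \<noteq> k"
      by auto
    from that J_def J' have "J = (S i i \<union> S j i \<union> S j j) \<union> (S i k \<union> S k k \<union> S k j)"
      by blast
    from K33_hexagon_chords[OF arc A B disj ijk this]
    show "S i j - {A i, B j} \<subseteq> inside J \<or> S i j - {A i, B j} \<subseteq> outside J"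
      "\<not> (S i j - {A i, B j} \<subseteq> inside J \<and> S j k - {A j, B k} \<subseteq> inside J)"
      "\<not> (S i j - {A i, B j} \<subseteq> outside J \<and> S j k - {A j, B k} \<subseteq> outside J)"
      by blast+
  qed
  show False
    using chords[of 0 1 2] chords[of 1 2 0] chords[of 2 0 1] by fast
qed

section \<open>From graph drawings to systems of arcs\<close>

lemma planar_drawing_arc_between:
  assumes "planar_drawing G p \<gamma>" "{u, v} \<in> edges G"
  shows "arc_between (path_image (\<gamma> {u, v})) (p u) (p v)"
proof -
  have "arc (\<gamma> {u, v})" "{pathstart (\<gamma> {u, v}), pathfinish (\<gamma> {u, v})} = {p u, p v}"
    using assms unfolding planar_drawing_def by auto
  \<comment> \<open>A drawing prescribes the two ends only as a set, so the path may have to be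
    reversed.\<close>
  then show ?thesis
    unfolding arc_between_def doubleton_eq_iff
    by (metis arc_reversepath path_image_reversepath pathfinish_reversepath pathstart_reversepath)
qed

lemma planar_drawing_inter:
  assumes "planar_drawing G p \<gamma>" "e \<in> edges G" "f \<in> edges G" "e \<noteq> f"
  shows "path_image (\<gamma> e) \<inter> path_image (\<gamma> f) = p ` (e \<inter> f)"
  using assms unfolding planar_drawing_def by blast

text \<open>
  The arc \<open>P\<close> stands for the edge \<open>{a0, b0}\<close>, so that \<open>K33\<close> itself and the subdivision of one of
  its edges are both instances.
\<close>

lemma planar_no_K33_with_arc:
  assumes drawing: "planar_drawing G p \<gamma>" and dist: "distinct [a0, a1, a2, b0, b1, b2]"
    and edges: "\<And>a b. \<lbrakk>a \<in> {a0, a1, a2}; b \<in> {b0, b1, b2}; (a, b) \<noteq> (a0, b0)\<rbrakk> \<Longrightarrow> {a, b} \<in> edges G"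
    and P: "arc_between P (p a0) (p b0)"
    and PA: "\<And>b. b \<in> {b1, b2} \<Longrightarrow> P \<inter> path_image (\<gamma> {a0, b}) = {p a0}"
    and PB: "\<And>a. a \<in> {a1, a2} \<Longrightarrow> P \<inter> path_image (\<gamma> {a, b0}) = {p b0}"
    and PAB: "\<And>a b. a \<in> {a1, a2} \<Longrightarrow> b \<in> {b1, b2} \<Longrightarrow> P \<inter> path_image (\<gamma> {a, b}) = {}"
  shows False
proof -
  define A B where "A = (!) [a0, a1, a2]" and "B = (!) [b0, b1, b2]"
  have A_simps: "A 0 = a0" "A (Suc 0) = a1" "A 2 = a2" and B_simps: "B 0 = b0" "B (Suc 0) = b1" "B 2 = b2"
    unfolding A_def B_def by simp_all
  have lt3: "i < 3 \<longleftrightarrow> i = 0 \<or> i = Suc 0 \<or> i = 2" for i :: nat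
    by auto
  have A: "A i \<in> {a0, a1, a2}" and B: "B i \<in> {b0, b1, b2}" if "i < 3" for i
    using that unfolding lt3 by (auto simp: A_simps B_simps)
  have A': "A i \<in> {a1, a2}" and B': "B i \<in> {b1, b2}" if "i < 3" "i \<noteq> 0" for i
    using that unfolding lt3 by (auto simp: A_simps B_simps)
  have neq: "A i \<noteq> B j" if "i < 3" "j < 3" for i j
    using A[OF that(1)] B[OF that(2)] dist by auto
  have A_eq: "A i = A j \<longleftrightarrow> i = j" and B_eq: "B i = B j \<longleftrightarrow> i = j" if "i < 3" "j < 3" for i j
    using that dist unfolding lt3 by (auto simp: A_simps B_simps)
  have edge: "{A i, B j} \<in> edges G" if "i < 3" "j < 3" "(i, j) \<noteq> (0, 0)" for i j
    using that A[of i] B[of j] A_eq[of i 0] B_eq[of j 0] by (intro edges) (auto simp: A_simps B_simps)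
  have inter: "path_image (\<gamma> {A i, B j}) \<inter> path_image (\<gamma> {A k, B l}) = p ` ({A i, B j} \<inter> {A k, B l})"
    if "i < 3" "j < 3" "k < 3" "l < 3" "(i, j) \<noteq> (0, 0)" "(k, l) \<noteq> (0, 0)" "i \<noteq> k \<or> j \<noteq> l" for i j k l
  proof -
    have "{A i, B j} \<noteq> {A k, B l}"
      using that neq[of i l] A_eq[of i k] B_eq[of j l] unfolding doubleton_eq_iff by metis
    then show ?thesis
      using that by (intro planar_drawing_inter[OF drawing] edge)
  qed
  \<comment> \<open>Only the pair \<open>(0, 0)\<close> uses \<open>P\<close>. Each intersection
    below is treated according to whether one of its two arcs is this one.\<close>
  define S where "S i j = (if i = 0 \<and> j = 0 then P else path_image (\<gamma> {A i, B j}))" for i j :: nat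
  show False
  proof (rule K33_not_planar)
    fix i j :: nat assume "i < 3" "j < 3"
    then show "arc_between (S i j) ((p \<circ> A) i) ((p \<circ> B) j)"
      using P A_simps B_simps planar_drawing_arc_between[OF drawing edge[of i j]] by (auto simp: S_def)
  next
    fix i j l :: nat assume *: "i < 3" "j < 3" "l < 3" "j \<noteq> l"
    consider "i = 0" "j = 0" | "i = 0" "l = 0" | "(i, j) \<noteq> (0, 0)" "(i, l) \<noteq> (0, 0)"
      by auto
    then show "S i j \<inter> S i l = {(p \<circ> A) i}"
    proof cases
      case 3
      have "{A i, B j} \<inter> {A i, B l} = {A i}"
        using * neq[of i] B_eq[of j l] by auto
      with 3 show ?thesis
        using inter[of i j i l] * unfolding S_def by auto
    qed (use * PA[of "B j"] PA[of "B l"] B' in \<open>simp_all add: S_def A_simps B_simps Int_commute\<close>)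
  next
    fix i j k :: nat assume *: "i < 3" "j < 3" "k < 3" "i \<noteq> k"
    consider "i = 0" "j = 0" | "k = 0" "j = 0" | "(i, j) \<noteq> (0, 0)" "(k, j) \<noteq> (0, 0)"
      by auto
    then show "S i j \<inter> S k j = {(p \<circ> B) j}"
    proof cases
      case 3
      have "{A i, B j} \<inter> {A k, B j} = {B j}"
        using * neq[of _ j] A_eq[of i k] by auto
      with 3 show ?thesis
        using inter[of i j k j] * unfolding S_def by auto
    qed (use * PB[of "A i"] PB[of "A k"] A' in \<open>simp_all add: S_def A_simps B_simps Int_commute\<close>)
  next
    fix i j k l :: nat assume *: "i < 3" "j < 3" "k < 3" "l < 3" "i \<noteq> k" "j \<noteq> l"
    consider "i = 0" "j = 0" | "k = 0" "l = 0" | "(i, j) \<noteq> (0, 0)" "(k, l) \<noteq> (0, 0)"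
      by auto
    then show "S i j \<inter> S k l = {}"
    proof cases
      case 3
      have "{A i, B j} \<inter> {A k, B l} = {}"
        using * neq[of i l] neq[of k j] A_eq[of i k] B_eq[of j l] by auto
      with 3 show ?thesis
        using inter[of i j k l] * unfolding S_def by auto
    qed (use * PAB[of "A i" "B j"] PAB[of "A k" "B l"] A' B' in \<open>simp_all add: S_def A_simps B_simps Int_commute\<close>)
  qed
qed

lemma planar_no_K33:
  assumes "planar_graph G" and dist: "distinct [a0, a1, a2, b0, b1, b2]"
    and edges: "\<And>a b. a \<in> {a0, a1, a2} \<Longrightarrow> b \<in> {b0, b1, b2} \<Longrightarrow> {a, b} \<in> edges G"
  shows False
proof -
  obtain p \<gamma> where drawing: "planar_drawing G p \<gamma>"
    using assms(1) unfolding planar_graph_def by blast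
  have inter: "path_image (\<gamma> {a0, b0}) \<inter> path_image (\<gamma> {a, b}) = p ` ({a0, b0} \<inter> {a, b})"
    if "a \<in> {a0, a1, a2}" "b \<in> {b0, b1, b2}" "(a, b) \<noteq> (a0, b0)" for a b
    using that dist by (intro planar_drawing_inter[OF drawing] edges) (auto simp: doubleton_eq_iff)
  show False
  proof (rule planar_no_K33_with_arc[OF drawing dist])
    show "arc_between (path_image (\<gamma> {a0, b0})) (p a0) (p b0)"
      by (intro planar_drawing_arc_between[OF drawing] edges) auto
    show "path_image (\<gamma> {a0, b0}) \<inter> path_image (\<gamma> {a0, b}) = {p a0}" if "b \<in> {b1, b2}" for b
      using that dist inter[of a0 b] by auto
    show "path_image (\<gamma> {a0, b0}) \<inter> path_image (\<gamma> {a, b0}) = {p b0}" if "a \<in> {a1, a2}" for a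
      using that dist inter[of a b0] by auto
    show "path_image (\<gamma> {a0, b0}) \<inter> path_image (\<gamma> {a, b}) = {}" if "a \<in> {a1, a2}" "b \<in> {b1, b2}" for a b
      using that dist inter[of a b] by auto
  qed (rule edges)
qed

text \<open>The two arcs at \<open>s\<close> meet only in the point of \<open>s\<close>, so their
  union is again an arc and takes the place of the missing edge.\<close>

lemma planar_no_K33_subdivided:
  assumes "planar_graph G" and dist: "distinct [a0, a1, a2, b0, b1, b2, s]"
    and s: "{a0, s} \<in> edges G" "{s, b0} \<in> edges G"
    and edges: "\<And>a b. \<lbrakk>a \<in> {a0, a1, a2}; b \<in> {b0, b1, b2}; (a, b) \<noteq> (a0, b0)\<rbrakk> \<Longrightarrow> {a, b} \<in> edges G"
  shows False
proof -
  obtain p \<gamma> where drawing: "planar_drawing G p \<gamma>"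
    using assms(1) unfolding planar_graph_def by blast
  have inter: "path_image (\<gamma> e) \<inter> path_image (\<gamma> {a, b}) = p ` (e \<inter> {a, b})"
    if "e \<in> {{a0, s}, {s, b0}}" "a \<in> {a0, a1, a2}" "b \<in> {b0, b1, b2}" "(a, b) \<noteq> (a0, b0)" for e a b
  proof (rule planar_drawing_inter[OF drawing])
    show "e \<noteq> {a, b}"
      using that(1-3) dist by (auto simp: doubleton_eq_iff)
  qed (use that s edges in auto)
  have "path_image (\<gamma> {a0, s}) \<inter> path_image (\<gamma> {s, b0}) = p ` ({a0, s} \<inter> {s, b0})"
    using dist by (intro planar_drawing_inter[OF drawing] s) (auto simp: doubleton_eq_iff)
  also have "\<dots> = {p s}"
    using dist by auto
  finally have s_inter: "path_image (\<gamma> {a0, s}) \<inter> path_image (\<gamma> {s, b0}) = {p s}" .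
  let ?P = "path_image (\<gamma> {a0, s}) \<union> path_image (\<gamma> {s, b0})"
  have dist': "distinct [a0, a1, a2, b0, b1, b2]"
    using dist by simp
  show False
  proof (rule planar_no_K33_with_arc[OF drawing dist' edges])
    show "arc_between ?P (p a0) (p b0)"
      using s s_inter by (intro arc_between_join[of _ _ "p s"] planar_drawing_arc_between[OF drawing])
    show "?P \<inter> path_image (\<gamma> {a0, b}) = {p a0}" if "b \<in> {b1, b2}" for b
      using that dist inter[of "{a0, s}" a0 b] inter[of "{s, b0}" a0 b] by (auto simp: Int_Un_distrib2)
    show "?P \<inter> path_image (\<gamma> {a, b0}) = {p b0}" if "a \<in> {a1, a2}" for a
      using that dist inter[of "{a0, s}" a b0] inter[of "{s, b0}" a b0] by (auto simp: Int_Un_distrib2)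
    show "?P \<inter> path_image (\<gamma> {a, b}) = {}" if "a \<in> {a1, a2}" "b \<in> {b1, b2}" for a b
      using that dist inter[of "{a0, s}" a b] inter[of "{s, b0}" a b] by (auto simp: Int_Un_distrib2)
  qed
qed

section \<open>Connected 2-line e.c. graphs\<close>

definition adj :: "'a ugraph \<Rightarrow> 'a \<Rightarrow> 'a \<Rightarrow> bool" where
  "adj G u v \<longleftrightarrow> {u, v} \<in> edges G"

lemma adj_sym: "adj G u v \<longleftrightarrow> adj G v u"
  unfolding adj_def by (simp add: insert_commute)

locale connected_two_line_ec =
  fixes G :: "'a ugraph"
  assumes simple: "simple_graph G" and connected: "connected_graph G" and ec: "two_line_ec G"
begin

lemma edge_subset_verts: "e \<in> edges G \<Longrightarrow> e \<subseteq> verts G" and card_edge: "e \<in> edges G \<Longrightarrow> card e = 2"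
  using simple unfolding simple_graph_def by simp_all

lemma adjD:
  assumes "adj G u v"
  shows "u \<in> verts G" "v \<in> verts G" "u \<noteq> v"
  using edge_subset_verts[of "{u, v}"] card_edge[of "{u, v}"] assms unfolding adj_def by auto

lemma edgeE:
  assumes "e \<in> edges G"
  obtains u v where "e = {u, v}" "adj G u v"
  using card_edge[OF assms] that assms unfolding adj_def card_2_iff by metis

lemma edge_with_vertexE:
  assumes "e \<in> edges G" "v \<in> e"
  obtains u where "e = {v, u}" "adj G v u"
proof -
  obtain a b where "e = {a, b}" "adj G a b"
    using edgeE[OF assms(1)] .
  then show ?thesis
    using that assms(2) adj_sym by (metis empty_iff insert_commute insert_iff)
qed

text \<open>An edge outside \<open>B\<close> that is not adjacent to \<open>b\<close> differs from
  \<open>b\<close> and hence is disjoint from it. The next three lemmas are the ways to distribute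
  two edges over \<open>A\<close> and \<open>B\<close>.\<close>

lemma ec_extend:
  assumes "A \<subseteq> edges G" "B \<subseteq> edges G" "A \<inter> B = {}" "card (A \<union> B) = 2"
  obtains g where "g \<in> edges G" "g \<notin> A \<union> B" "\<And>a. a \<in> A \<Longrightarrow> g \<inter> a \<noteq> {}" "\<And>b. b \<in> B \<Longrightarrow> g \<inter> b = {}"
proof -
  obtain g where g: "g \<in> edges G" "g \<notin> A \<union> B" "\<forall>a\<in>A. adjacent_edges g a" "\<forall>b\<in>B. \<not> adjacent_edges g b"
    using ec assms unfolding two_line_ec_def by meson
  then have "g \<inter> b = {}" if "b \<in> B" for b
    using that unfolding adjacent_edges_def by (metis UnI2)
  then show ?thesis
    using that[of g] g(1-3) unfolding adjacent_edges_def by metis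
qed

lemma edge_meeting_both:
  assumes "e \<in> edges G" "f \<in> edges G" "e \<noteq> f"
  obtains g where "g \<in> edges G" "g \<noteq> e" "g \<noteq> f" "g \<inter> e \<noteq> {}" "g \<inter> f \<noteq> {}"
  by (rule ec_extend[of "{e, f}" "{}"]) (use assms that in auto)

lemma edge_meeting_one:
  assumes "e \<in> edges G" "f \<in> edges G" "e \<noteq> f"
  obtains g where "g \<in> edges G" "g \<noteq> e" "g \<inter> e \<noteq> {}" "g \<inter> f = {}"
  by (rule ec_extend[of "{e}" "{f}"]) (use assms that in auto)

lemma edge_meeting_none:
  assumes "e \<in> edges G" "f \<in> edges G" "e \<noteq> f"
  obtains g where "g \<in> edges G" "g \<inter> e = {}" "g \<inter> f = {}"
  by (rule ec_extend[of "{}" "{e, f}"]) (use assms that in auto)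

lemma two_edges:
  obtains e f where "e \<in> edges G" "f \<in> edges G" "e \<noteq> f"
proof -
  have "card (edges G) \<ge> 2"
    using ec unfolding two_line_ec_def by blast
  then have "\<not> edges G \<subseteq> {e}" for e
    using card_mono[of "{e}" "edges G"] by auto
  then obtain e f where "e \<in> edges G" "f \<in> edges G - {e}"
    by blast
  then show ?thesis
    using that by blast
qed

text \<open>A walk from a vertex of \<open>S\<close> to one outside has a step that leaves
  \<open>S\<close>.\<close>

lemma connected_boundary:
  assumes "S \<subseteq> verts G" "S \<noteq> {}" "S \<noteq> verts G"
  obtains s u where "s \<in> S" "u \<in> verts G" "u \<notin> S" "adj G s u"
proof -
  obtain a b where ab: "a \<in> S" "b \<in> verts G" "b \<notin> S"
    using assms by blast
  then have "(a, b) \<in> {(x, y). {x, y} \<in> edges G}\<^sup>*"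
    using assms connected unfolding connected_graph_def by blast
  then have "b \<notin> S \<longrightarrow> (\<exists>s\<in>S. \<exists>u. u \<notin> S \<and> adj G s u)"
    using ab(1) by (induction rule: rtrancl_induct) (auto simp: adj_def)
  then show ?thesis
    using that ab(3) adjD by blast
qed

lemma ex_neighbour:
  assumes "v \<in> verts G"
  obtains u where "adj G v u"
proof -
  obtain x y where "adj G x y"
    using two_edges edgeE by metis
  then have "{v} \<noteq> verts G"
    using adjD by (metis singletonD)
  then show ?thesis
    using connected_boundary[of "{v}"] assms that by auto
qed

text \<open>If \<open>v\<close> had at most two neighbours, some edge \<open>g\<close> off
  \<open>v\<close> would contain all of them: an edge adjacent to both edges at \<open>v\<close>
  must join their other ends, and with a single edge at \<open>v\<close> any edge adjacent to it
  will do. But an edge adjacent to \<open>{v, a}\<close> and disjoint from \<open>g\<close> misses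
  \<open>a\<close>, so it is an edge at \<open>v\<close>, and its other end lies in
  \<open>g\<close>.\<close>

lemma min_degree_3:
  assumes v: "v \<in> verts G"
  shows "\<exists>u. adj G v u \<and> u \<noteq> x \<and> u \<noteq> y"
proof (rule ccontr)
  assume "\<not> ?thesis"
  then have N: "u = x \<or> u = y" if "adj G v u" for u
    using that by blast
  obtain a where a: "adj G v a"
    using ex_neighbour[OF v] .
  have va: "{v, a} \<in> edges G"
    using a unfolding adj_def .
  have "\<exists>g\<in>edges G. v \<notin> g \<and> (\<forall>u. adj G v u \<longrightarrow> u \<in> g)"
  proof (cases "\<exists>b. adj G v b \<and> b \<noteq> a")
    case True
    then obtain b where b: "adj G v b" "b \<noteq> a"
      by blast
    then have "{v, b} \<in> edges G" "{v, a} \<noteq> {v, b}"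
      unfolding adj_def by (auto simp: doubleton_eq_iff)
    with va obtain g where g: "g \<in> edges G" "g \<noteq> {v, a}" "g \<noteq> {v, b}" "g \<inter> {v, a} \<noteq> {}" "g \<inter> {v, b} \<noteq> {}"
      using edge_meeting_both by metis
    have ab: "u = a \<or> u = b" if "adj G v u" for u
      using N[OF that] N[OF a] N[OF b(1)] b(2) by blast
    have "v \<notin> g"
      using edge_with_vertexE[OF g(1)] ab g(2,3) by metis
    then show ?thesis
      using g(1,4,5) ab by blast
  next
    case False
    obtain f where "f \<in> edges G" "f \<noteq> {v, a}"
      using two_edges by metis
    then obtain g where g: "g \<in> edges G" "g \<noteq> {v, a}" "g \<inter> {v, a} \<noteq> {}"
      using edge_meeting_both[OF va] by metis
    have "v \<notin> g"
      using edge_with_vertexE[OF g(1)] False g(2) by metis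
    then show ?thesis
      using g(1,3) False by blast
  qed
  then obtain g where g: "g \<in> edges G" "v \<notin> g" "\<And>u. adj G v u \<Longrightarrow> u \<in> g"
    by blast
  have "{v, a} \<noteq> g"
    using g(2) by auto
  then obtain h where h: "h \<in> edges G" "h \<inter> {v, a} \<noteq> {}" "h \<inter> g = {}"
    using edge_meeting_one[OF va g(1)] by metis
  then have "v \<in> h"
    using g(3)[OF a] by blast
  then obtain u where "h = {v, u}" "adj G v u"
    using edge_with_vertexE[OF h(1)] by blast
  then show False
    using g(3) h(3) by blast
qed

text \<open>An edge adjacent to two disjoint edges has one end in each.\<close>

lemma no_induced_2K2:
  assumes "adj G a b" "adj G c d" "\<not> adj G a c" "\<not> adj G a d" "\<not> adj G b c" "\<not> adj G b d"
    and "a \<noteq> c" "a \<noteq> d" "b \<noteq> c" "b \<noteq> d"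
  shows False
proof -
  have "{a, b} \<in> edges G" "{c, d} \<in> edges G" "{a, b} \<noteq> {c, d}"
    using assms unfolding adj_def by (auto simp: doubleton_eq_iff)
  then obtain g where g: "g \<in> edges G" "g \<inter> {a, b} \<noteq> {}" "g \<inter> {c, d} \<noteq> {}"
    using edge_meeting_both by metis
  obtain x y where "g = {x, y}" "adj G x y"
    using edgeE[OF g(1)] .
  then have "x \<in> {a, b} \<and> y \<in> {c, d} \<or> y \<in> {a, b} \<and> x \<in> {c, d}"
    using g(2,3) assms(7-10) by auto
  then show False
    using \<open>adj G x y\<close> assms(3-6) adj_sym by (metis empty_iff insert_iff)
qed

text \<open>This is the case of an empty \<open>A\<close>: the ends of two distinct edges, which may
  share a vertex, never cover all edges.\<close>

lemma edge_avoiding_two_edges: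
  assumes "adj G a b" "adj G c d" "{a, b} \<noteq> {c, d}"
  obtains x y where "adj G x y" "x \<notin> {a, b, c, d}" "y \<notin> {a, b, c, d}"
proof -
  obtain g where "g \<in> edges G" "g \<inter> {a, b} = {}" "g \<inter> {c, d} = {}"
    using edge_meeting_none[of "{a, b}" "{c, d}"] assms unfolding adj_def by metis
  moreover from this obtain x y where "g = {x, y}" "adj G x y"
    using edgeE by metis
  ultimately show ?thesis
    using that by blast
qed

end

section \<open>Growing induced subgraphs\<close>

text \<open>
  Entry \<open>j\<close> of row \<open>i\<close> tells whether the vertices \<open>i\<close> and \<open>j < i\<close> are adjacent. The last row may be
  shorter than its index: the adjacency of the last vertex to the remaining ones is then undetermined.
\<close>

type_synonym rows = "bool list list"

text \<open>The values \<open>True\<close> and \<open>False\<close> are not complementary: on an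
  undetermined pair neither is known.\<close>

definition known :: "rows \<Rightarrow> bool \<Rightarrow> nat \<Rightarrow> nat \<Rightarrow> bool" where
  "known M b i j \<longleftrightarrow>
     (if j < i then i < length M \<and> j < length (M ! i) \<and> M ! i ! j = b
      else j < length M \<and> i < length (M ! j) \<and> M ! j ! i = b)"

definition copy :: "('a \<Rightarrow> 'a \<Rightarrow> bool) \<Rightarrow> rows \<Rightarrow> 'a list \<Rightarrow> bool" where
  "copy E M vs \<longleftrightarrow> length vs = length M \<and> distinct vs \<and>
     (\<forall>i<length M. length (M ! i) \<le> i \<and> (\<forall>j<length (M ! i). M ! i ! j \<longleftrightarrow> E (vs ! i) (vs ! j)))"

text \<open>
  A search tree determines the neighbours of a new vertex, numbered \<open>length H\<close>, among the vertices of
  an induced subgraph \<open>H\<close> one by one. Its leaves say why a branch is closed: by an induced \<open>2K2\<close>, by a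
  \<open>K33\<close> or a \<open>K33\<close> whose edge between its first and fourth argument is subdivided by its last one, by
  an induced copy of the \<open>k\<close>-th graph treated before, or because the new vertex has no neighbour in \<open>H\<close>.
\<close>

datatype search_tree =
  Split search_tree search_tree
| Two_K2 nat nat nat nat
| K33 nat nat nat nat nat nat
| K33_sub nat nat nat nat nat nat nat
| Copy nat "nat list"
| Isolated

text \<open>
  Why an induced subgraph \<open>H\<close> is not the whole graph, or else is one of the five graphs: its vertex 0 has
  at most two neighbours, or two edges of \<open>H\<close> cover all its edges, or \<open>H\<close> is the graph of index \<open>k\<close>
  with the vertices shifted by one. In the first case the new vertex may be taken adjacent to vertex 0.
\<close>

datatype step = Low_degree search_tree | Covered nat nat nat nat search_tree | Listed nat search_tree

text \<open>\<open>r\<close> is the row of the new vertex as far as it is decided. The leaves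
  consult it through \<open>known\<close>, so what they find persists however the other entries turn
  out; only \<open>Isolated\<close> needs the whole row. In \<open>Copy k p\<close>, vertex
  \<open>i\<close> of the earlier graph is placed at \<open>p ! i\<close>, and testing non-edges as
  well as edges makes the copy induced.\<close>

fun check_tree :: "rows list \<Rightarrow> rows \<Rightarrow> bool list \<Rightarrow> search_tree \<Rightarrow> bool" where
  "check_tree Hs H r (Split s t) \<longleftrightarrow> length r < length H \<and>
     check_tree Hs H (r @ [True]) s \<and> check_tree Hs H (r @ [False]) t"
| "check_tree Hs H r (Two_K2 a b c d) \<longleftrightarrow> (let M = H @ [r] in
     known M True a b \<and> known M True c d \<and>
     known M False a c \<and> known M False a d \<and> known M False b c \<and> known M False b d)"
| "check_tree Hs H r (K33 a0 a1 a2 b0 b1 b2) \<longleftrightarrow> (let M = H @ [r] in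
     distinct [a0, a1, a2, b0, b1, b2] \<and>
     known M True a0 b0 \<and> known M True a0 b1 \<and> known M True a0 b2 \<and>
     known M True a1 b0 \<and> known M True a1 b1 \<and> known M True a1 b2 \<and>
     known M True a2 b0 \<and> known M True a2 b1 \<and> known M True a2 b2)"
| "check_tree Hs H r (K33_sub a0 a1 a2 b0 b1 b2 s) \<longleftrightarrow> (let M = H @ [r] in
     distinct [a0, a1, a2, b0, b1, b2, s] \<and>
     known M True a0 s \<and> known M True s b0 \<and> known M True a0 b1 \<and> known M True a0 b2 \<and>
     known M True a1 b0 \<and> known M True a1 b1 \<and> known M True a1 b2 \<and>
     known M True a2 b0 \<and> known M True a2 b1 \<and> known M True a2 b2)"
| "check_tree Hs H r (Copy k p) \<longleftrightarrow> k < length Hs \<and> (let K = Hs ! k; M = H @ [r] in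
     length p = length K \<and> distinct p \<and> (\<forall>i\<in>set p. i < length M) \<and>
     (\<forall>i\<in>set [0..<length K]. length (K ! i) = i \<and>
        (\<forall>j\<in>set [0..<i]. known M (K ! i ! j) (p ! i) (p ! j))))"
| "check_tree Hs H r Isolated \<longleftrightarrow> length r = length H \<and> True \<notin> set r"

definition Tc_pairs :: "(nat \<times> nat) list list" where
  "Tc_pairs = (let ps = [(1,2), (1,3), (1,4), (2,3), (2,5), (2,7), (3,6), (3,7), (4,5), (4,6), (5,7), (6,7)] in
     [ps, ps @ [(5,6)], ps @ [(1,5), (1,6)], ps @ [(1,5), (1,6), (5,6)], ps @ [(1,5), (1,6), (4,7)]])"

text \<open>The row handed to the tree records what is known of the new vertex: adjacent to vertex 0
  after \<open>Low_degree\<close>, nothing otherwise. In \<open>Covered\<close>, the condition on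
  \<open>a\<close> makes the two edges distinct while they may still share \<open>b\<close>.\<close>

fun check_step :: "rows list \<Rightarrow> rows \<Rightarrow> step \<Rightarrow> bool" where
  "check_step Hs H (Low_degree t) \<longleftrightarrow> 0 < length H \<and>
     length (filter (\<lambda>j. \<not> known H False 0 j) [1..<length H]) \<le> 2 \<and> check_tree Hs H [True] t"
| "check_step Hs H (Covered a b c d t) \<longleftrightarrow> known H True a b \<and> known H True c d \<and>
     a \<noteq> c \<and> a \<noteq> d \<and>
     (\<forall>i\<in>set [0..<length H]. i \<in> {a, b, c, d} \<or>
        (\<forall>j\<in>set [0..<i]. j \<in> {a, b, c, d} \<or> known H False i j)) \<and>
     check_tree Hs H [] t"
| "check_step Hs H (Listed k t) \<longleftrightarrow> k < 5 \<and> length H = 7 \<and>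
     (\<forall>i\<in>set [0..<7]. \<forall>j\<in>set [0..<i]. known H ((Suc j, Suc i) \<in> set (Tc_pairs ! k)) i j) \<and>
     check_tree Hs H [] t"

definition rows_of :: "nat list list \<Rightarrow> rows" where
  "rows_of ns = map (\<lambda>(i, js). map (\<lambda>j. j \<in> set js) [0..<i]) (List.enumerate 0 ns)"

text \<open>A graph enters \<open>Hs\<close> only after its own check, so copies refer to earlier
  graphs and the argument is not circular. The one-vertex graph must be reached in the end.\<close>

fun check_steps :: "rows list \<Rightarrow> (nat list list \<times> step) list \<Rightarrow> bool" where
  "check_steps Hs [] \<longleftrightarrow> rows_of [[]] \<in> set Hs"
| "check_steps Hs ((ns, s) # ss) \<longleftrightarrow> (let H = rows_of ns in check_step Hs H s \<and> check_steps (Hs @ [H]) ss)"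

section \<open>Induced copies and their extensions by one vertex\<close>

lemma copy_known:
  assumes "copy E M vs" "known M b i j" "\<And>u v. E u v \<longleftrightarrow> E v u"
  shows "i < length vs" "j < length vs" "i \<noteq> j" "vs ! i \<noteq> vs ! j" "E (vs ! i) (vs ! j) = b"
proof -
  have *: "i < length vs \<and> j < length vs \<and> i \<noteq> j \<and> E (vs ! i) (vs ! j) = b"
  proof (cases "j < i")
    case True
    then show ?thesis
      using assms(1,2) unfolding copy_def known_def by fastforce
  next
    case False
    then have j: "j < length M" "i < length (M ! j)" "M ! j ! i = b"
      using assms(2) unfolding known_def by auto
    then have "length (M ! j) \<le> j" "E (vs ! j) (vs ! i) = b"
      using assms(1) unfolding copy_def by auto
    then show ?thesis
      using j assms(1,3) unfolding copy_def by auto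
  qed
  then show "i < length vs" "j < length vs" "i \<noteq> j" "E (vs ! i) (vs ! j) = b"
    by auto
  then show "vs ! i \<noteq> vs ! j"
    using assms(1) nth_eq_iff_index_eq unfolding copy_def by blast
qed

text \<open>\<open>r\<close> may be shorter than \<open>vs\<close>: the vertex is added before all
  its adjacencies are decided.\<close>

lemma copy_snoc:
  assumes "copy E H vs" "u \<notin> set vs" "length r \<le> length vs" "\<forall>j<length r. r ! j = E u (vs ! j)"
  shows "copy E (H @ [r]) (vs @ [u])"
  unfolding copy_def
proof (intro conjI allI impI)
  show "length (vs @ [u]) = length (H @ [r])" "distinct (vs @ [u])"
    using assms(1,2) unfolding copy_def by auto
  have len: "length vs = length H"
    using assms(1) unfolding copy_def by simp
  fix i assume "i < length (H @ [r])"
  then consider "i < length H" | "i = length H"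
    by fastforce
  then have "length ((H @ [r]) ! i) \<le> i \<and>
    (\<forall>j<length ((H @ [r]) ! i). (H @ [r]) ! i ! j \<longleftrightarrow> E ((vs @ [u]) ! i) ((vs @ [u]) ! j))"
    using assms(1,3,4) len unfolding copy_def by cases (auto simp: nth_append)
  then show "length ((H @ [r]) ! i) \<le> i"
    "\<And>j. j < length ((H @ [r]) ! i) \<Longrightarrow> (H @ [r]) ! i ! j \<longleftrightarrow> E ((vs @ [u]) ! i) ((vs @ [u]) ! j)"
    by auto
qed

lemma copy_distinct_nth:
  assumes "copy E M vs" "distinct is" "set is \<subseteq> {..<length vs}"
  shows "distinct (map ((!) vs) is)"
  using assms unfolding copy_def distinct_map by (auto intro!: inj_on_nth)

section \<open>Soundness of the search trees\<close>

locale planar_two_line_ec = connected_two_line_ec +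
  assumes planar: "planar_graph G"
begin

text \<open>If \<open>G\<close> is none of the five graphs, this says that \<open>H\<close> is not
  an induced subgraph of \<open>G\<close>. With the five graphs in the conclusion, they need not be
  treated as exceptions along the way.\<close>

definition excluded :: "rows \<Rightarrow> bool" where
  "excluded H \<longleftrightarrow> (\<forall>vs. set vs \<subseteq> verts G \<longrightarrow> copy (adj G) H vs \<longrightarrow> (\<exists>i<5. graph_iso G (Tc_graphs ! i)))"

lemma excludedD: "\<lbrakk>excluded H; set vs \<subseteq> verts G; copy (adj G) H vs\<rbrakk> \<Longrightarrow> \<exists>i<5. graph_iso G (Tc_graphs ! i)"
  unfolding excluded_def by blast

text \<open>The row agrees with the actual adjacencies of \<open>u\<close>, so every
  \<open>Split\<close> is followed along the true branch. The leaf reached is contradictory, or it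
  is a \<open>Copy\<close> and hands over to an earlier graph. The neighbour \<open>v\<close> of
  \<open>u\<close> refutes \<open>Isolated\<close>.\<close>

lemma check_tree_sound:
  assumes ex: "\<forall>K\<in>set Hs. excluded K"
    and vs: "set vs \<subseteq> verts G" "copy (adj G) H vs"
    and u: "u \<in> verts G" "u \<notin> set vs" "v \<in> set vs" "adj G u v"
    and "check_tree Hs H r t" "length r \<le> length vs" "\<forall>j<length r. r ! j = adj G u (vs ! j)"
  shows "\<exists>i<5. graph_iso G (Tc_graphs ! i)"
  using assms(8-)
proof (induction t arbitrary: r)
  case (Split s t)
  define b where "b = adj G u (vs ! length r)"
  have "length r < length vs"
    using Split.prems(1) vs(2) unfolding copy_def by simp
  moreover have "\<forall>j<length (r @ [b]). (r @ [b]) ! j = adj G u (vs ! j)"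
    using Split.prems(3) unfolding b_def by (auto simp: nth_append less_Suc_eq)
  ultimately show ?case
    using Split.IH[of "r @ [b]"] Split.prems(1) by (cases b) auto
next
  case (Two_K2 a b c d)
  note M = copy_snoc[OF vs(2) u(2) Two_K2.prems(2,3)]
  show ?case
    using Two_K2.prems(1) copy_known(4,5)[OF M _ adj_sym]
      no_induced_2K2[of "(vs @ [u]) ! a" "(vs @ [u]) ! b" "(vs @ [u]) ! c" "(vs @ [u]) ! d"]
    unfolding check_tree.simps Let_def by metis
next
  case (K33 a0 a1 a2 b0 b1 b2)
  note M = copy_snoc[OF vs(2) u(2) K33.prems(2,3)]
  let ?w = "(!) (vs @ [u])"
  note known = copy_known[OF M _ adj_sym]
  have check: "distinct [a0, a1, a2, b0, b1, b2]"
    "\<And>a b. a \<in> {a0, a1, a2} \<Longrightarrow> b \<in> {b0, b1, b2} \<Longrightarrow> known (H @ [r]) True a b"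
    using K33.prems(1) by (auto simp: Let_def)
  have "a < length (vs @ [u])" if "a \<in> {a0, a1, a2}" for a
    using known(1)[OF check(2)[OF that]] by blast
  moreover have "b < length (vs @ [u])" if "b \<in> {b0, b1, b2}" for b
    using known(2)[OF check(2)[OF _ that]] by blast
  ultimately have "set [a0, a1, a2, b0, b1, b2] \<subseteq> {..<length (vs @ [u])}"
    by simp
  then have "distinct [?w a0, ?w a1, ?w a2, ?w b0, ?w b1, ?w b2]"
    using copy_distinct_nth[OF M check(1)] by (simp only: list.map)
  moreover have "{x, y} \<in> edges G" if "x \<in> {?w a0, ?w a1, ?w a2}" "y \<in> {?w b0, ?w b1, ?w b2}" for x y
    using that known(5)[OF check(2)] unfolding adj_def by blast
  ultimately show ?case
    using planar_no_K33[OF planar] by blast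
next
  case (K33_sub a0 a1 a2 b0 b1 b2 s)
  note M = copy_snoc[OF vs(2) u(2) K33_sub.prems(2,3)]
  let ?w = "(!) (vs @ [u])"
  note known = copy_known[OF M _ adj_sym]
  have check: "distinct [a0, a1, a2, b0, b1, b2, s]"
    "\<And>a b. a \<in> {a0, a1, a2} \<Longrightarrow> b \<in> {b0, b1, b2} \<Longrightarrow> (a, b) \<noteq> (a0, b0) \<Longrightarrow> known (H @ [r]) True a b"
    "known (H @ [r]) True a0 s" "known (H @ [r]) True s b0"
    using K33_sub.prems(1) by (auto simp: Let_def)
  have "a < length (vs @ [u])" if "a \<in> {a0, a1, a2}" for a
    using that known(1)[OF check(3)] known(1)[OF check(2), of a b1] check(1) by auto
  moreover have "b < length (vs @ [u])" if "b \<in> {b0, b1, b2}" for b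
    using that known(2)[OF check(4)] known(2)[OF check(2), of a1 b] check(1) by auto
  ultimately have "set [a0, a1, a2, b0, b1, b2, s] \<subseteq> {..<length (vs @ [u])}"
    using known(2)[OF check(3)] by simp
  then have *: "distinct [?w a0, ?w a1, ?w a2, ?w b0, ?w b1, ?w b2, ?w s]"
    using copy_distinct_nth[OF M check(1)] by (simp only: list.map)
  moreover have "{x, y} \<in> edges G"
    if "x \<in> {?w a0, ?w a1, ?w a2}" "y \<in> {?w b0, ?w b1, ?w b2}" "(x, y) \<noteq> (?w a0, ?w b0)" for x y
    using that known(5)[OF check(2)] unfolding adj_def by blast
  ultimately show ?case
    using planar_no_K33_subdivided[OF planar *] known(5)[OF check(3)] known(5)[OF check(4)]
    unfolding adj_def by blast
next
  case (Copy k p)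
  note M = copy_snoc[OF vs(2) u(2) Copy.prems(2,3)]
  note known = copy_known[OF M _ adj_sym]
  define ws where "ws = map ((!) (vs @ [u])) p"
  have k: "k < length Hs" "length p = length (Hs ! k)" "distinct p"
    "\<And>i j. i < length p \<Longrightarrow> j < i \<Longrightarrow> known (H @ [r]) (Hs ! k ! i ! j) (p ! i) (p ! j)"
    "\<And>i. i < length p \<Longrightarrow> length (Hs ! k ! i) = i"
    using Copy.prems(1) by (auto simp: Let_def)
  have p: "set p \<subseteq> {..<length (vs @ [u])}"
    using Copy.prems(1) vs(2) unfolding copy_def by (auto simp: Let_def)
  have "distinct ws"
    unfolding ws_def by (rule copy_distinct_nth[OF M k(3) p])
  then have "copy (adj G) (Hs ! k) ws"
    using k(2,5) known(5)[OF k(4)] unfolding copy_def ws_def by simp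
  moreover have "set ws \<subseteq> verts G"
    using p vs(1) u(1) unfolding ws_def by (auto simp: nth_append)
  ultimately show ?case
    using excludedD[OF bspec[OF ex nth_mem[OF k(1)]]] by blast
next
  case Isolated
  then have "length r = length vs" "True \<notin> set r"
    using vs(2) unfolding copy_def by auto
  then show ?case
    using u(3,4) Isolated.prems(3) unfolding in_set_conv_nth by metis
qed

end

section \<open>The five graphs as lists of ordered pairs\<close>

lemma Tc_graphs_eq:
  "Tc_graphs = map (\<lambda>ps. ({1, 2, 3, 4, 5, 6, 7}, (\<lambda>(i, j). {i, j}) ` set ps)) Tc_pairs"
  unfolding Tc_graphs_def Tc_pairs_def Tc20_def Tc30_def Tc39_def Tc43_def Tc44_def Let_def
  by (simp add: insert_commute)

lemma Tc_graphs_nth: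
  assumes "k < 5"
  shows "Tc_graphs ! k = ({1, 2, 3, 4, 5, 6, 7}, (\<lambda>(i, j). {i, j}) ` set (Tc_pairs ! k))"
proof -
  have "length Tc_pairs = 5"
    by (simp add: Tc_pairs_def Let_def)
  then show ?thesis
    unfolding Tc_graphs_eq using assms by simp
qed

text \<open>With the smaller end first, every edge is represented by exactly one pair, so being an
  edge reduces to membership in a list.\<close>

lemma Tc_pairs_ordered:
  assumes "k < 5" "(i, j) \<in> set (Tc_pairs ! k)"
  shows "i < j"
proof -
  have "\<forall>ps\<in>set Tc_pairs. \<forall>(i, j)\<in>set ps. i < j" "length Tc_pairs = 5"
    by (simp_all add: Tc_pairs_def Let_def)
  then show ?thesis
    using assms nth_mem[of k Tc_pairs] by fastforce
qed

lemma Tc_edge_iff: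
  assumes "k < 5" "i < j"
  shows "{i, j} \<in> edges (Tc_graphs ! k) \<longleftrightarrow> (i, j) \<in> set (Tc_pairs ! k)"
proof
  assume "{i, j} \<in> edges (Tc_graphs ! k)"
  then obtain a b where ab: "{i, j} = {a, b}" "(a, b) \<in> set (Tc_pairs ! k)"
    unfolding Tc_graphs_nth[OF assms(1)] by auto
  then show "(i, j) \<in> set (Tc_pairs ! k)"
    using Tc_pairs_ordered[OF assms(1) ab(2)] assms(2) by (auto simp: doubleton_eq_iff)
next
  assume "(i, j) \<in> set (Tc_pairs ! k)"
  then show "{i, j} \<in> edges (Tc_graphs ! k)"
    unfolding Tc_graphs_nth[OF assms(1)] by (auto intro!: image_eqI[of _ _ "(i, j)"])
qed

lemma set_subset_doubleton:
  assumes "length xs \<le> 2"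
  shows "\<exists>x y. set xs \<subseteq> {x, y}"
proof (cases xs)
  case (Cons x ys)
  with assms show ?thesis
    by (cases ys) auto
qed simp

section \<open>Soundness of the steps and of the whole certificate\<close>

context planar_two_line_ec
begin

lemma check_step_sound:
  assumes ex: "\<forall>K\<in>set Hs. excluded K" and check: "check_step Hs H s"
  shows "excluded H"
  unfolding excluded_def
proof (intro allI impI)
  fix vs assume vs: "set vs \<subseteq> verts G" "copy (adj G) H vs"
  have len: "length vs = length H" and dist: "distinct vs"
    using vs(2) unfolding copy_def by auto
  note known = copy_known[OF vs(2) _ adj_sym]
  note sound = check_tree_sound[OF ex vs]
  \<comment> \<open>If the copy is not all of \<open>G\<close>, connectedness supplies an outside
    vertex adjacent to it, about which nothing else is known; hence the empty row.\<close>
  have other: "\<exists>i<5. graph_iso G (Tc_graphs ! i)" if other: "set vs \<noteq> verts G" "H \<noteq> []" "check_tree Hs H [] t" for t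
  proof -
    have "set vs \<noteq> {}"
      using other(2) len by auto
    then obtain v u where "v \<in> set vs" "u \<in> verts G" "u \<notin> set vs" "adj G v u"
      using connected_boundary[OF vs(1)] other(1) by metis
    then show ?thesis
      using sound[of u v "[]"] other(3) adj_sym[of G u v] by auto
  qed
  show "\<exists>i<5. graph_iso G (Tc_graphs ! i)"
  proof (cases s)
    case (Low_degree t)
    let ?js = "filter (\<lambda>j. \<not> known H False 0 j) [1..<length H]"
    have H: "0 < length H" "length ?js \<le> 2" "check_tree Hs H [True] t"
      using check Low_degree by auto
    \<comment> \<open>When fewer than two candidates exist, \<open>x\<close> or \<open>y\<close> may
      be no index of \<open>vs\<close>. This is harmless, because \<open>min_degree_3\<close> avoids
      any two given values.\<close>
    obtain x y where xy: "set ?js \<subseteq> {x, y}"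
      using set_subset_doubleton[OF H(2)] by blast
    have v0: "vs ! 0 \<in> set vs"
      using H(1) len by auto
    then obtain u where u: "adj G (vs ! 0) u" "u \<noteq> vs ! x" "u \<noteq> vs ! y"
      using min_degree_3[of "vs ! 0" "vs ! x" "vs ! y"] vs(1) by blast
    have "u \<notin> set vs"
    proof
      assume "u \<in> set vs"
      then obtain j where j: "j < length vs" "u = vs ! j"
        unfolding in_set_conv_nth by blast
      then have "j \<noteq> 0"
        using adjD(3)[OF u(1)] by metis
      moreover have "j \<notin> set ?js"
        using xy u(2,3) j(2) by blast
      ultimately have "known H False 0 j"
        using j(1) len by auto
      then show False
        using known(5) u(1) j(2) by blast
    qed
    then show ?thesis
      using sound[OF adjD(2)[OF u(1)] _ v0 _ H(3)] u(1) adj_sym[of G "vs ! 0" u] H(1) len by (simp add: Suc_le_eq)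
  next
    case (Covered a b c d t)
    have H: "known H True a b" "known H True c d" "a \<noteq> c" "a \<noteq> d" "check_tree Hs H [] t"
      "\<And>i j. \<lbrakk>i < length H; i \<notin> {a, b, c, d}; j < i; j \<notin> {a, b, c, d}\<rbrakk> \<Longrightarrow> known H False i j"
      using check Covered by (auto simp: Ball_def)
    \<comment> \<open>One end of the first edge is not on the second, so the edges are
      distinct.\<close>
    have ne: "vs ! a \<noteq> vs ! c" "vs ! a \<noteq> vs ! d"
      using H(3,4) known(1,2)[OF H(1)] known(1,2)[OF H(2)] dist nth_eq_iff_index_eq by metis+
    then obtain x y where xy: "adj G x y" "x \<notin> {vs ! a, vs ! b, vs ! c, vs ! d}"
      "y \<notin> {vs ! a, vs ! b, vs ! c, vs ! d}"
      using edge_avoiding_two_edges[of "vs ! a" "vs ! b" "vs ! c" "vs ! d"] known(5)[OF H(1)] known(5)[OF H(2)]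
      by (metis insertI1 insertE singletonD)
    \<comment> \<open>Otherwise the edge \<open>{x, y}\<close> would lie inside the copy and miss
      both edges, although \<open>H\<close> has no such edge.\<close>
    have "set vs \<noteq> verts G"
    proof
      assume "set vs = verts G"
      then obtain i j where ij: "i < length H" "j < length H" "x = vs ! i" "y = vs ! j"
        using adjD(1,2)[OF xy(1)] len by (metis in_set_conv_nth)
      have "i \<notin> {a, b, c, d}" "j \<notin> {a, b, c, d}"
        using xy(2,3) ij(3,4) by auto
      moreover have "i \<noteq> j"
        using adjD(3)[OF xy(1)] ij by auto
      ultimately have "known H False i j \<or> known H False j i"
        using H(6) ij by (meson nat_neq_iff)
      then show False
        using known(5) xy(1) ij adj_sym by metis
    qed
    moreover have "H \<noteq> []"
      using known(1)[OF H(1)] len by auto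
    ultimately show ?thesis
      using other H(5) by blast
  next
    case (Listed k t)
    then have H: "k < 5" "length H = 7" "check_tree Hs H [] t"
      "\<And>i j. i < 7 \<Longrightarrow> j < i \<Longrightarrow> known H ((Suc j, Suc i) \<in> set (Tc_pairs ! k)) i j"
      using check by (auto simp: Ball_def)
    show ?thesis
    proof (cases "set vs = verts G")
      case True
      \<comment> \<open>\<open>f\<close> inverts \<open>vs\<close> and adds one, since the listed
        graphs are numbered from 1; positions are unique because \<open>vs\<close> is
        distinct.\<close>
      define f where "f v = Suc (THE i. i < length vs \<and> vs ! i = v)" for v
      have f: "f (vs ! i) = Suc i" if "i < length vs" for i
        unfolding f_def using that dist nth_eq_iff_index_eq by (intro arg_cong[of _ _ Suc] the_equality) auto
      have V: "verts G = (\<lambda>i. vs ! i) ` {..<7}"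
        using True len H(2) by (auto simp: set_conv_nth)
      have seven: "verts (Tc_graphs ! k) = Suc ` {..<7}"
        unfolding Tc_graphs_nth[OF H(1)] by (auto simp: image_iff less_Suc_eq numeral_eq_Suc)
      have "bij_betw f (verts G) (verts (Tc_graphs ! k))"
        unfolding V seven using f len H(2)
        by (intro bij_betw_imageI inj_onI) (auto simp: image_image)
      moreover have lt: "adj G (vs ! i) (vs ! j) \<longleftrightarrow> {f (vs ! i), f (vs ! j)} \<in> edges (Tc_graphs ! k)"
        if "i < 7" "j < i" for i j
        using known(5)[OF H(4)[OF that]] Tc_edge_iff[OF H(1), of "Suc j" "Suc i"] f len H(2) that
        by (simp add: insert_commute)
      have "{u, v} \<in> edges G \<longleftrightarrow> {f u, f v} \<in> edges (Tc_graphs ! k)" if uv: "u \<in> verts G" "v \<in> verts G" for u v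
      proof -
        obtain i j where ij: "i < 7" "j < 7" "u = vs ! i" "v = vs ! j"
          using uv unfolding V by blast
        consider "j < i" | "i < j" | "i = j"
          by linarith
        then show ?thesis
        proof cases
          case 3
          have "{Suc i, Suc i} \<notin> edges (Tc_graphs ! k)"
            using Tc_pairs_ordered[OF H(1)] unfolding Tc_graphs_nth[OF H(1)] by fastforce
          then show ?thesis
            using 3 ij f len H(2) adjD(3)[of u u] unfolding adj_def by auto
        qed (use lt[of i j] lt[of j i] ij in \<open>simp_all add: adj_def insert_commute\<close>)
      qed
      ultimately show ?thesis
        using H(1) unfolding graph_iso_def by blast
    next
      case False
      moreover have "H \<noteq> []"
        using H(2) by auto
      ultimately show ?thesis
        using other H(3) by blast
    qed
  qed
qed

text \<open>All graphs in \<open>Hs\<close> stay excluded throughout. At the end this applies to the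
  one-vertex graph, of which any vertex of \<open>G\<close> is a copy.\<close>

lemma check_steps_sound:
  assumes "\<forall>K\<in>set Hs. excluded K" "check_steps Hs ss"
  shows "\<exists>i<5. graph_iso G (Tc_graphs ! i)"
  using assms
proof (induction Hs ss rule: check_steps.induct)
  case (1 Hs)
  then have "excluded [[]]"
    by (simp add: rows_of_def)
  moreover obtain v where "v \<in> verts G"
    using connected unfolding connected_graph_def by blast
  moreover have "copy (adj G) [[]] [v]"
    unfolding copy_def by simp
  ultimately show ?case
    using excludedD[of "[[]]" "[v]"] by simp
next
  case (2 Hs ns s ss)
  then show ?case
    using check_step_sound[of Hs "rows_of ns" s] by (auto simp: Let_def)
qed

end

text \<open>
  Found by a backtracking search over the extensions. Each induced subgraph is given by the earlier
  neighbours of its vertices.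
\<close>

definition certificate :: "(nat list list \<times> step) list" where
  "certificate = [
   ([[], [], [1], [2], [3], [0,1,2,4], [0,1,3,4,5]], Low_degree (Split (Split
     (K33_sub 2 0 1 6 5 7 3) (Split (K33_sub 4 0 1 7 6 5 3) (Two_K2 7 0 3 2))) (Split (Split (Split
     (K33_sub 3 4 0 5 6 7 2) (Split (Split (K33_sub 6 3 5 2 4 7 1) (Two_K2 7 2 4 6))
     (Two_K2 7 3 5 1))) (Split (K33_sub 0 4 2 3 5 7 6) (Two_K2 7 0 4 3))) (Two_K2 7 0 2 1)))),
   ([[], [], [1], [1], [3], [0,2,3], [0,1,2,3,4]], Low_degree (Split (K33_sub 0 2 3 1 5 6 7) (Split
     (Split (K33 3 2 0 5 6 7) (Two_K2 7 0 3 1)) (Two_K2 7 0 1 2)))),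
   ([[], [], [1], [1], [2,3], [0,1,3,4], [2,4,5], [1,5,6]], Low_degree (Split (Split (Split
     (K33_sub 8 4 1 5 2 3 0) (Split (Split (K33_sub 7 3 8 4 1 5 6) (Two_K2 8 2 3 5))
     (Two_K2 8 0 3 4))) (Split (Split (Split (K33_sub 7 3 8 4 1 5 6) (Split (K33 1 4 6 2 5 8)
     (Two_K2 8 3 2 6))) (Two_K2 8 0 4 2)) (Split (Split (K33_sub 7 3 8 4 1 5 6) (Split
     (K33 1 4 6 2 5 8) (Two_K2 8 0 2 6))) (Two_K2 8 0 3 4)))) (Split (Split (K33_sub 8 4 1 5 2 3 0)
     (Two_K2 8 0 1 3)) (Two_K2 8 0 1 2)))),
   ([[], [], [1], [1,2], [0,2,3], [3,4], [1,4], [0,1,3,5,6]], Low_degree (Split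
     (K33_sub 1 7 4 0 3 6 8) (Split (Split (K33_sub 2 3 0 7 4 8 1) (Two_K2 8 0 3 1))
     (Two_K2 8 0 2 1)))),
   ([[], [], [0], [1,2], [0,1], [0,1,2,3,4], [2,3,4]], Covered 2 3 4 5 (Split (Split (Split
     (K33_sub 2 0 1 4 5 7 6) (Split (K33_sub 3 0 1 4 5 7 6) (Split (Two_K2 7 4 2 3) (Split
     (K33_sub 1 0 5 2 4 7 3) (Split (K33_sub 1 0 6 2 4 7 5) (Two_K2 7 1 2 6)))))) (Split (Split
     (K33_sub 3 2 4 0 6 5 7) (Two_K2 7 0 1 3)) (Split (K33_sub 3 2 4 0 6 5 7) (Two_K2 7 0 1 3))))
     (Split (Split (K33_sub 1 6 5 2 4 3 7) (Two_K2 7 1 0 2)) (Split (Split (Split (K33 4 2 3 6 5 7)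
     (Two_K2 7 2 1 4)) (Split (Split (K33_sub 1 0 7 2 4 5 3) (Split (Two_K2 7 6 1 5)
     (Copy 3 [7,3,1,5,4,0,6,2]))) (Two_K2 7 2 1 4))) (Split (Split (Split (K33_sub 0 1 7 3 5 4 2)
     (Split (Two_K2 7 6 1 5) (Copy 3 [7,2,0,5,4,1,6,3]))) (Two_K2 7 3 4 0)) (Split (Two_K2 7 4 2 3)
     (Split (Split (Copy 1 [7,0,2,4,1,6,5]) (Copy 2 [7,4,6,0,2,5,3,1])) (Split (Two_K2 7 6 1 5)
     Isolated)))))))),
   ([[], [], [1], [1], [0,1,3], [0,2,3,4], [1,2,4,5]], Low_degree (Split (K33_sub 0 3 6 1 5 4 7)
     (Split (Split (K33_sub 0 3 2 1 5 7 4) (Two_K2 7 0 3 1)) (Two_K2 7 0 1 2)))),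
   ([[], [], [1], [0,1,2], [1,3], [1,2], [2,3], [0,1,2,4,5,6]], Low_degree (Split
     (K33_sub 1 3 7 0 2 4 8) (Split (K33_sub 2 3 7 0 1 6 8) (Two_K2 8 0 2 1)))),
   ([[], [], [1], [1], [0,2,3], [3,4], [2,3,4], [0,1,2,3,4,5]], Low_degree (Split
     (K33_sub 0 2 3 1 7 4 8) (Split (Split (K33 3 2 0 7 4 8) (Two_K2 8 0 3 1)) (Two_K2 8 0 1 2)))),
   ([[], [], [1], [1,2], [1,2], [2,4], [0,2,3,4,5], [3,4,6]], Low_degree (Split (Split
     (K33_sub 8 3 4 6 1 2 0) (Split (Split (K33_sub 6 3 4 8 2 7 0) (Two_K2 8 0 4 2))
     (Two_K2 8 0 3 2))) (Split (Split (Split (K33 4 3 2 1 6 8) (Two_K2 8 0 4 1)) (Two_K2 8 0 3 1))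
     (Two_K2 8 0 1 2)))),
   ([[], [], [], [1,2], [2], [0,1,2,4], [2,3,5], [1,2,3,4,5]], Low_degree (Split (Split
     (K33_sub 2 3 5 1 6 7 8) (Split (Split (K33_sub 4 5 3 1 7 2 8) (Two_K2 8 1 4 2))
     (Two_K2 8 0 3 2))) (Split (Split (K33_sub 5 3 2 8 7 6 0) (Two_K2 8 0 1 3)) (Split (Split
     (K33_sub 5 4 3 8 2 7 0) (Two_K2 8 0 4 2)) (Two_K2 8 0 1 3))))),
   ([[], [], [0], [1,2], [0,1,3], [0,1,2,3,4], [0,3,4]], Covered 0 4 3 5 (Split (Split
     (K33_sub 1 6 5 0 3 4 7) (Split (Split (Split (K33 3 0 4 6 5 7) (Two_K2 7 2 1 4))
     (Two_K2 7 0 1 3)) (Split (Split (K33 3 0 4 6 5 7) (Split (K33 3 0 5 2 4 7) (Split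
     (Two_K2 7 6 1 5) (Copy 6 [7,5,4,0,2,1,6,3])))) (Two_K2 7 0 1 3)))) (Split (Split
     (K33_sub 1 3 0 2 4 5 7) (Two_K2 7 1 0 2)) (Split (Split (Split (K33_sub 4 0 3 2 6 5 7)
     (Two_K2 7 2 1 4)) (Split (K33_sub 4 0 3 2 6 5 7) (Two_K2 7 2 1 4))) (Split (Split (Split
     (K33_sub 6 1 7 5 4 3 0) (Split (Two_K2 7 6 1 5) (Copy 5 [7,0,2,6,4,3,5]))) (Split (Split
     (K33_sub 3 6 5 0 4 7 2) (Copy 5 [7,0,6,2,5,3,4])) (Split (Two_K2 7 6 1 5)
     (Copy 9 [7,6,5,0,1,3,2,4])))) (Split (Split (Split (K33 3 0 7 6 4 5)
     (Copy 7 [7,6,0,3,5,1,2,4])) (Split (Two_K2 7 6 1 5) (Copy 8 [7,2,5,0,3,1,4,6]))) (Split (Split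
     (K33_sub 5 0 3 6 2 4 7) (Copy 8 [7,6,4,0,3,1,5,2])) (Split (Two_K2 7 6 1 5) Isolated)))))))),
   ([[], [], [1], [1], [0,1,2], [0,1,2,3]], Low_degree (Split (Split (K33 5 4 6 2 0 1) (Split (Split
     (Split (Copy 10 [4,3,2,5,6,1,0]) (Copy 4 [3,2,6,4,5,1,0])) (Two_K2 6 3 2 4)) (Split (Split
     (Copy 5 [3,4,0,2,1,5,6]) (Two_K2 6 4 3 5)) (Split (Copy 0 [3,2,4,0,6,1,5])
     (Copy 1 [6,2,4,5,3,0,1]))))) (Split (Split (K33_sub 3 2 0 4 5 6 1) (Two_K2 6 0 3 1))
     (Two_K2 6 0 2 1)))),
   ([[], [], [1], [1], [0,2,3], [0,2,3,4]], Low_degree (Split (K33_sub 0 2 3 1 5 4 6) (Split (Split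
     (K33 0 2 3 5 4 6) (Two_K2 6 0 1 3)) (Two_K2 6 0 2 1)))),
   ([[], [], [1], [1], [0,1,2], [3,4], [0,2,3]], Low_degree (Split (Split (K33_sub 1 2 0 6 4 7 3)
     (Split (Split (Split (K33_sub 0 1 5 3 4 7 6) (Copy 11 [5,1,7,2,3,4])) (Two_K2 7 3 2 4)) (Split
     (Split (K33_sub 0 1 5 3 4 7 6) (Two_K2 7 0 5 3)) (Split (K33_sub 0 1 5 3 4 7 6)
     (Two_K2 7 0 5 3))))) (Split (Split (K33_sub 0 2 3 1 6 7 4) (Two_K2 7 0 3 1))
     (Two_K2 7 0 1 2)))),
   ([[], [], [1], [], [2,3], [0,1,2,3], [0,1,3,4]], Low_degree (Split (Split (K33_sub 2 1 0 6 5 7 4)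
     (Split (K33 0 1 3 6 5 7) (Split (K33_sub 0 1 4 2 6 7 5) (Two_K2 7 0 2 4)))) (Split (Split
     (K33_sub 1 0 3 7 5 6 2) (Split (Split (Copy 11 [3,2,7,1,4,5]) (Two_K2 7 4 1 5))
     (Two_K2 7 0 4 3))) (Two_K2 7 0 1 2)))),
   ([[], [], [1], [2], [0,1,2,3], [1,2], [0,1,3,5]], Low_degree (Split (Split
     (K33_sub 0 3 1 2 6 4 7) (Split (K33 0 3 1 6 4 7) (Two_K2 7 0 3 2))) (Split
     (K33_sub 0 3 1 2 6 4 7) (Two_K2 7 0 2 1)))),
   ([[], [0], [0,1], [0], [1,3], [2,3], [1,2,4,5]], Listed 0 (Split (Split (Split (Split
     (K33_sub 4 0 7 2 1 3 6) (Split (K33_sub 2 4 0 3 1 7 5) (Two_K2 7 2 3 4))) (Split (Split (Split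
     (K33_sub 0 4 5 6 3 7 1) (Two_K2 7 4 5 2)) (Copy 11 [4,0,7,2,3,1])) (Split
     (Copy 11 [3,1,7,2,4,0]) (Split (K33_sub 1 5 0 3 2 7 4) (Two_K2 7 1 3 5))))) (Split (Split
     (Split (K33_sub 2 4 0 3 1 7 5) (Split (Two_K2 7 5 4 1) (Copy 11 [5,0,7,1,3,2]))) (Split
     (K33_sub 2 4 0 3 1 7 5) (Two_K2 7 2 3 4))) (Split (Two_K2 7 3 1 2) (Split (Split
     (K33_sub 0 4 5 6 3 7 1) (Two_K2 7 4 5 2)) (Split (Two_K2 7 5 4 1) (Split
     (Copy 11 [7,1,2,4,0,6]) (Two_K2 7 0 4 6))))))) (Split (Split (Split (K33_sub 4 0 7 2 1 3 6)
     (Split (K33_sub 0 6 7 4 1 2 3) (Two_K2 7 2 3 4))) (Split (Split (Two_K2 7 4 0 2) (Split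
     (Copy 14 [4,7,5,0,2,3,1]) (Split (K33_sub 0 4 7 6 3 1 2) (Two_K2 7 3 6 2)))) (Split
     (Two_K2 7 4 0 2) (Split (Copy 13 [4,2,0,5,1,7,3]) (Two_K2 7 1 3 5))))) (Split (Split (Split
     (Split (Two_K2 7 5 0 1) (Copy 14 [5,7,4,0,1,3,2])) (Split (Two_K2 7 5 0 1) (Split
     (K33_sub 0 5 7 6 3 2 1) (Two_K2 7 3 6 1)))) (Split (Split (Two_K2 7 5 0 1)
     (Copy 13 [5,1,0,4,2,7,3])) (Two_K2 7 2 3 4))) (Split (Two_K2 7 3 1 2) (Split (Two_K2 7 4 0 2)
     (Split (Two_K2 7 5 0 1) (Split (Two_K2 7 6 0 3) Isolated)))))))),
   ([[], [], [1], [1], [0,1,2], [0,2,3]], Low_degree (Split (Split (K33_sub 5 4 6 1 0 2 3) (Split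
     (Split (Split (Copy 4 [0,3,4,1,5,6,2]) (Copy 16 [2,1,4,5,3,0,6])) (Two_K2 6 3 2 4)) (Split
     (Split (Copy 15 [3,6,4,2,1,0,5]) (Two_K2 6 4 3 5)) (Split (Copy 14 [3,6,0,2,4,5,1])
     (Copy 13 [3,4,2,0,1,6,5]))))) (Split (Split (K33_sub 3 2 0 4 5 6 1) (Two_K2 6 0 3 1))
     (Two_K2 6 0 2 1)))),
   ([[], [], [1], [1], [0,1,2,3], [0,2,3,4]], Low_degree (Split (K33_sub 0 3 2 1 5 4 6) (Split
     (Split (K33 0 3 2 5 4 6) (Two_K2 6 0 3 1)) (Two_K2 6 0 1 2)))),
   ([[], [], [1], [0,2], [1,3], [0,2,4], [2,3]], Low_degree (Split (K33_sub 1 5 3 0 4 2 7) (Split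
     (Split (Split (K33 3 5 7 4 0 2) (Two_K2 7 0 4 1)) (Split (K33 3 5 7 4 0 2) (Two_K2 7 0 4 1)))
     (Two_K2 7 0 2 1)))),
   ([[], [], [], [2], [0,1,3], [0,1,2,3]], Low_degree (Split (Split (K33_sub 2 0 1 4 5 6 3) (Split
     (K33 5 4 6 0 1 3) (Two_K2 6 0 2 3))) (Split (Split (Split (Split (Copy 11 [1,6,0,2,4,5])
     (Copy 15 [1,3,6,0,4,2,5])) (Two_K2 6 2 4 1)) (Split (Split (Copy 11 [1,6,0,2,4,5])
     (Copy 14 [1,0,6,3,2,4,5])) (Two_K2 6 2 4 1))) (Split (Split (Split (Copy 11 [1,3,6,2,4,5])
     (Two_K2 6 4 2 5)) (Split (Copy 1 [1,6,0,3,2,4,5]) (Copy 19 [6,1,5,3,4,0,2])))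
     (Two_K2 6 0 2 3))))),
   ([[], [], [], [2], [0,1,2], [0,1,3]], Low_degree (Split (Split (K33_sub 5 4 6 2 1 0 3) (Split
     (K33_sub 3 0 1 4 5 6 2) (Two_K2 6 0 3 2))) (Split (Split (Split (Split (Copy 11 [1,6,0,3,4,5])
     (Two_K2 6 2 5 1)) (Two_K2 6 3 4 1)) (Split (Split (Copy 11 [1,6,0,2,5,4]) (Two_K2 6 4 3 5))
     (Split (Copy 13 [1,6,0,2,5,3,4]) (Two_K2 6 2 5 1)))) (Split (Split (Split
     (Copy 11 [1,6,0,3,4,5]) (Copy 13 [1,6,0,3,4,2,5])) (Two_K2 6 3 4 1)) (Two_K2 6 0 3 2))))),
   ([[], [], [1], [1], [0,2,3], [0,2,3]], Low_degree (Split (K33_sub 1 5 4 0 3 2 6) (Split (Split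
     (K33 3 0 2 5 4 6) (Two_K2 6 0 1 3)) (Two_K2 6 0 1 2)))),
   ([[], [], [1], [1], [0,1,2,3], [0,2,3]], Low_degree (Split (K33_sub 0 3 2 1 5 4 6) (Split (Split
     (K33 0 3 2 5 4 6) (Two_K2 6 0 3 1)) (Two_K2 6 0 1 2)))),
   ([[], [], [1], [1], [0,2,3]], Low_degree (Split (Split (Split (Split (Copy 18 [0,1,3,2,5,4])
     (Copy 23 [0,1,3,2,5,4])) (Split (Copy 11 [3,5,2,0,1,4]) (Copy 17 [0,1,2,3,5,4]))) (Split (Split
     (Copy 11 [2,5,3,0,1,4]) (Copy 17 [0,1,3,2,5,4])) (Split (Copy 20 [2,3,0,5,1,4])
     (Copy 21 [2,3,0,5,4,1])))) (Split (Split (Split (Copy 12 [0,1,2,3,4,5])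
     (Copy 22 [1,0,4,5,3,2])) (Two_K2 5 0 1 3)) (Two_K2 5 0 2 1)))),
   ([[], [], [1], [1,2], [1,2,3], [0,2,3,4]], Low_degree (Split (Split (K33_sub 5 1 2 6 3 4 0)
     (Split (K33_sub 5 1 3 6 2 4 0) (Two_K2 6 0 2 3))) (Split (Split (Split (K33 5 1 6 4 2 3)
     (Two_K2 6 0 4 1)) (Two_K2 6 0 1 3)) (Two_K2 6 0 1 2)))),
   ([[], [0], [0,1], [0], [0,1,3], [0,2,3], [1,2,4,5]], Listed 2 (Split (Split (Split (Split
     (K33_sub 2 1 3 4 0 7 6) (Split (K33 4 1 2 6 0 7) (Two_K2 7 2 3 4))) (Split
     (K33_sub 3 1 0 2 4 7 5) (Split (Split (K33 4 1 5 6 0 7) (Two_K2 7 4 2 5)) (Split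
     (K33_sub 3 2 7 1 5 0 4) (Two_K2 7 1 3 5))))) (Split (Split (K33_sub 2 3 0 4 5 7 1) (Split
     (K33_sub 3 1 7 2 4 0 5) (Two_K2 7 2 3 4))) (Split (Two_K2 7 3 1 2) (Split (Split
     (K33_sub 1 3 7 5 4 0 2) (Two_K2 7 4 2 5)) (Split (Two_K2 7 5 4 1) (Split
     (Copy 11 [7,4,1,3,6,0]) (Copy 24 [7,6,4,2,0]))))))) (Split (Split (Split
     (K33_sub 2 1 3 4 0 7 6) (Split (K33 4 1 2 6 0 7) (Two_K2 7 2 3 4))) (Split
     (K33_sub 3 6 0 1 4 5 7) (Split (Split (K33 4 1 5 6 0 7) (Two_K2 7 4 2 5)) (Split
     (K33_sub 5 2 4 1 6 0 7) (Two_K2 7 1 3 5))))) (Split (Split (K33_sub 3 6 0 2 4 5 7) (Split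
     (K33_sub 4 1 5 2 6 0 7) (Two_K2 7 2 3 4))) (Split (Two_K2 7 3 1 2) (Split (Split
     (Copy 11 [7,0,3,1,5,4]) (Two_K2 7 4 2 5)) (Split (Two_K2 7 5 4 1) (Split (Two_K2 7 6 3 0)
     Isolated)))))))),
   ([[], [0], [0,1], [0], [1,3], [2,3,4], [1,2,4,5]], Listed 1 (Split (Split (Split (Split
     (K33_sub 6 0 7 3 1 2 5) (Split (K33_sub 0 6 7 4 1 2 3) (Two_K2 7 2 4 3))) (Split (Split (Split
     (K33_sub 0 1 5 4 2 7 3) (Split (K33_sub 0 1 6 4 2 7 3) (Two_K2 7 0 6 5)))
     (Copy 11 [4,0,7,2,3,1])) (Split (Copy 11 [3,1,7,2,4,0]) (Split (K33_sub 0 1 5 4 2 7 3)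
     (Two_K2 7 0 5 4))))) (Split (Split (Split (K33_sub 0 5 7 4 3 2 1) (Split (Split
     (K33_sub 5 6 0 1 2 7 4) (Two_K2 7 0 6 4)) (Two_K2 7 0 5 4))) (Split (K33_sub 0 4 2 5 1 7 3)
     (Two_K2 7 2 4 3))) (Split (Two_K2 7 3 1 2) (Split (Copy 20 [7,3,2,1,4,0])
     (Copy 24 [7,4,1,3,0]))))) (Split (Split (Split (K33_sub 6 0 7 3 1 2 5) (Split
     (K33_sub 0 6 7 4 1 2 3) (Two_K2 7 2 4 3))) (Split (Split (Two_K2 7 4 0 2)
     (Copy 20 [7,4,2,0,3,1])) (Split (Two_K2 7 4 0 2) (Copy 24 [7,3,0,4,1])))) (Split (Split (Split
     (K33_sub 0 5 7 4 3 2 1) (Copy 17 [4,2,0,7,1,3])) (Split (Copy 17 [3,2,1,7,0,4])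
     (Two_K2 7 2 4 3))) (Split (Two_K2 7 3 1 2) (Split (Two_K2 7 4 0 2) (Split (Two_K2 7 5 0 1)
     (Split (Two_K2 7 6 0 3) Isolated)))))))),
   ([[], [], [1], [1,2], [0,2,3], [0,1,2]], Low_degree (Split (Split (K33_sub 0 1 2 3 5 6 4) (Split
     (Split (Split (Copy 26 [6,1,3,0,5,4,2]) (Copy 27 [0,6,4,5,1,2,3])) (Split
     (Copy 27 [0,6,5,4,3,2,1]) (Copy 16 [6,1,3,0,5,4,2]))) (Two_K2 6 0 3 2))) (Split (Split
     (K33_sub 3 0 2 5 4 6 1) (Two_K2 6 0 1 3)) (Two_K2 6 0 1 2)))),
   ([[], [], [1], [1,2], [0,2,3], [0,1,2,3,4]], Low_degree (Split (K33_sub 0 2 3 1 4 5 6) (Split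
     (Split (K33 0 2 3 4 5 6) (Two_K2 6 0 1 3)) (Two_K2 6 0 2 1)))),
   ([[], [], [1], [1,2], [0,2,3], [0,1,2,3]], Low_degree (Split (K33_sub 0 2 3 1 4 5 6) (Split
     (Split (K33 0 2 3 4 5 6) (Two_K2 6 0 1 3)) (Two_K2 6 0 2 1)))),
   ([[], [0], [0,1], [0], [0,1,3], [0,2,3,4], [1,2,4,5]], Listed 3 (Split (Split (Split (Split
     (K33_sub 3 0 1 2 4 7 5) (Split (K33 0 6 7 1 2 4) (Two_K2 7 2 3 4))) (Split
     (K33_sub 3 0 1 2 4 7 5) (Split (Split (K33 0 1 5 2 4 7) (Two_K2 7 1 3 5)) (Split
     (K33 0 1 5 2 4 7) (Two_K2 7 1 3 5))))) (Split (Split (K33_sub 3 0 6 2 5 4 7) (Split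
     (K33 0 2 4 1 5 7) (Two_K2 7 2 3 4))) (Split (Two_K2 7 3 1 2) (Split (Split
     (K33_sub 1 3 7 5 0 4 6) (Copy 18 [7,2,5,1,0,4])) (Split (Copy 18 [7,1,4,2,0,5]) (Split
     (K33_sub 0 1 5 6 2 4 7) (Copy 24 [7,6,1,5,0]))))))) (Split (Split (Split
     (K33_sub 3 0 6 1 5 4 7) (Split (K33 0 6 7 1 2 4) (Two_K2 7 2 3 4))) (Split
     (K33_sub 3 0 6 1 5 4 7) (Split (Split (K33 0 6 7 1 5 4) (Two_K2 7 1 3 5)) (Split
     (K33_sub 1 0 6 5 2 4 7) (Two_K2 7 1 3 5))))) (Split (Split (K33_sub 3 0 6 2 5 4 7) (Split
     (K33_sub 2 6 0 4 5 1 7) (Two_K2 7 2 3 4))) (Split (Two_K2 7 3 1 2) (Split (Split (Split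
     (Two_K2 7 6 3 0) (Copy 18 [7,1,6,0,4,5])) (Copy 24 [7,2,1,5,4])) (Split (Copy 24 [7,1,2,4,5])
     (Split (Two_K2 7 6 3 0) Isolated)))))))),
   ([[], [], [1], [1,2], [0,2,3], [0,1,2,4]], Low_degree (Split (Split (K33_sub 0 1 2 3 5 6 4)
     (Split (Split (Split (Copy 31 [6,1,3,0,5,4,2]) (Copy 26 [4,3,2,0,6,5,1]))
     (Copy 28 [0,1,3,2,4,6])) (Two_K2 6 0 3 2))) (Split (Split (K33_sub 3 0 2 5 4 6 1)
     (Two_K2 6 0 1 3)) (Two_K2 6 0 1 2)))),
   ([[], [], [1], [0,2], [0,2,3]], Low_degree (Split (Split (Split (Split (Copy 29 [1,0,3,4,2,5])
     (Copy 32 [1,0,3,4,2,5])) (Split (Copy 32 [1,0,4,3,2,5]) (Two_K2 5 1 3 4))) (Split (Split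
     (Copy 30 [1,0,3,4,2,5]) (Copy 28 [1,0,3,4,2,5])) (Split (Copy 28 [1,0,4,3,2,5])
     (Two_K2 5 1 3 4)))) (Split (Split (Split (Copy 25 [1,0,3,4,5,2]) (Copy 24 [1,0,5,4,2]))
     (Copy 24 [1,0,5,3,2])) (Two_K2 5 0 1 2)))),
   ([[], [], [1], [1,2], [3], [1,4], [0,1,2,3,4,5]], Low_degree (Split (Split (Split (Split
     (K33 4 2 1 3 6 7) (Split (K33 5 3 2 1 6 7) (Two_K2 7 2 5 4))) (Copy 33 [3,0,7,2,1])) (Split
     (Copy 33 [2,0,7,3,1]) (Two_K2 7 0 3 2))) (Split (Split (Copy 33 [1,0,7,3,2]) (Two_K2 7 0 3 1))
     (Two_K2 7 0 2 1)))),
   ([[], [], [1], [0,1], [0,2,3], [0,1,2,3,4]], Covered 0 3 2 5 (Split (Split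
     (K33_sub 1 4 5 0 2 3 6) (Split (K33_sub 0 4 1 2 3 5 6) (Two_K2 6 0 1 2))) (Split (Split (Split
     (Copy 33 [2,0,3,6,1]) (Two_K2 6 2 0 3)) (Split (Split (Copy 11 [2,3,6,0,1,4]) (Two_K2 6 1 4 0))
     (Split (Copy 20 [6,2,0,3,1,4]) (Two_K2 6 1 4 0)))) (Split (Split (Copy 24 [0,2,6,1,3])
     (Two_K2 6 2 0 3)) (Split (Split (Split (K33_sub 1 0 6 4 3 5 2) (Copy 32 [6,2,5,1,3,4]))
     (Copy 24 [6,2,1,4,3])) (Split (Copy 24 [6,1,2,3,4]) (Split (Copy 34 [6,3,0,4,2,1,5])
     Isolated))))))),
   ([[], [], [1], [0,2], [0,1,3], [0,1,2,4]], Covered 1 2 0 4 (Split (Split (K33_sub 0 4 2 1 3 5 6)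
     (Split (Split (Copy 33 [0,1,2,6,3]) (Copy 24 [1,0,6,3,2])) (Two_K2 6 0 2 1))) (Split (Split
     (Split (Copy 33 [1,0,3,6,2]) (Two_K2 6 1 0 3)) (Split (Copy 24 [0,1,6,2,3]) (Two_K2 6 1 0 3)))
     (Split (Split (Split (Copy 11 [1,3,6,0,2,4]) (Two_K2 6 2 4 0)) (Split (Copy 20 [6,1,0,3,2,4])
     (Two_K2 6 2 4 0))) (Split (Split (Split (K33_sub 2 0 6 4 3 5 1) (Two_K2 6 3 1 5))
     (Copy 24 [6,1,2,4,3])) (Split (Copy 24 [6,2,1,3,4]) (Split (Copy 24 [6,3,2,4,5])
     Isolated))))))),
   ([[], [], [1], [0,1], [0,1,2], [0,2,3]], Covered 1 2 0 3 (Split (Split (Split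
     (K33_sub 3 4 6 2 1 0 5) (Split (Copy 33 [0,2,1,6,3]) (Copy 24 [2,0,6,3,1]))) (Split (Split
     (K33_sub 3 2 0 4 5 6 1) (Split (Copy 28 [3,6,4,2,1,0]) (Copy 17 [3,2,4,6,1,0])))
     (Two_K2 6 0 2 1))) (Split (Split (Split (Copy 33 [2,0,3,6,1]) (Two_K2 6 2 3 0)) (Split (Split
     (Copy 11 [0,1,6,2,3,4]) (Two_K2 6 3 2 4)) (Split (Split (K33_sub 3 2 6 4 5 1 0)
     (Two_K2 6 4 3 5)) (Copy 24 [6,0,3,4,1])))) (Split (Split (Copy 24 [0,2,6,1,3])
     (Two_K2 6 2 3 0)) (Split (Split (Copy 20 [6,0,2,1,3,4]) (Two_K2 6 3 2 4)) (Split
     (Copy 24 [6,3,1,0,4]) (Split (Two_K2 6 5 4 1) Isolated))))))),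
   ([[], [], [1], [0,2], [0,1,2]], Low_degree (Split (Split (Split (Split (Copy 35 [1,0,3,4,2,5])
     (Copy 36 [3,1,4,0,5,2])) (Split (Copy 30 [3,1,5,4,0,2]) (Copy 23 [3,1,4,5,2,0]))) (Split (Split
     (Copy 36 [0,1,2,3,5,4]) (Copy 37 [3,1,4,5,2,0])) (Split (Copy 28 [3,5,4,1,2,0])
     (Copy 17 [3,1,4,5,2,0])))) (Split (Split (Copy 33 [0,1,2,5,3]) (Copy 24 [1,0,5,3,2]))
     (Two_K2 5 0 2 1)))),
   ([[], [], [1], [2], [0,1,2,3], [3,4], [0,1,2,3,5], [1,4,5,6]], Low_degree (Split
     (K33_sub 1 4 6 0 2 7 8) (Split (K33_sub 0 3 1 2 4 6 8) (Two_K2 8 0 1 2)))),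
   ([[], [], [1], [1], [3], [2,4], [0,1,2,3,4,5]], Low_degree (Split (Split (Split (Split (Split
     (Split (K33_sub 3 5 6 2 4 7 1) (Copy 39 [0,3,1,2,7,5,6,4])) (Copy 24 [0,5,4,2,7]))
     (Copy 33 [2,4,3,7,1])) (Split (Copy 24 [0,3,4,1,7]) (Two_K2 7 2 3 4))) (Split (Split
     (Copy 33 [4,2,1,7,3]) (Split (Copy 17 [2,3,7,4,1,5]) (Two_K2 7 3 5 2))) (Split
     (Copy 24 [0,3,4,1,7]) (Two_K2 7 0 3 4)))) (Split (Split (Copy 24 [0,1,3,2,7]) (Two_K2 7 0 3 1))
     (Two_K2 7 0 2 1)))),
   ([[], [0], [0,1], [0], [0,1,3], [0,2,3], [1,2,3,4,5]], Listed 4 (Split (Split (Split (Split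
     (K33 1 2 3 0 6 7) (Split (K33 1 2 4 0 6 7) (Two_K2 7 2 3 4))) (Split (K33_sub 1 5 4 3 0 6 7)
     (Split (Split (K33 1 5 4 0 6 7) (Two_K2 7 1 5 3)) (Split (K33_sub 1 2 3 5 0 6 7)
     (Two_K2 7 1 5 3))))) (Split (Split (K33_sub 3 5 1 2 0 6 7) (Split (K33_sub 2 1 3 4 0 6 7)
     (Two_K2 7 2 3 4))) (Split (Two_K2 7 3 1 2) (Split (Split (K33_sub 5 1 3 4 0 6 7)
     (Two_K2 7 4 2 5)) (Split (Two_K2 7 5 1 4) (Copy 40 [7,4,3,1,2,5,0])))))) (Split (Split (Split
     (K33 1 2 3 0 6 7) (Copy 33 [7,3,0,1,2])) (Split (K33_sub 1 5 4 3 0 6 7) (Split (Split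
     (K33 1 5 4 0 6 7) (Two_K2 7 1 5 3)) (Copy 33 [3,7,1,4,0])))) (Split (Split
     (K33_sub 3 5 1 2 0 6 7) (Split (K33_sub 2 1 3 4 0 6 7) (Two_K2 7 2 3 4))) (Split
     (Two_K2 7 3 1 2) (Split (Copy 33 [2,7,4,1,0]) (Split (Two_K2 7 5 1 4) (Split
     (Copy 24 [7,0,1,5,6]) Isolated)))))))),
   ([[], [], [1], [0,2], [0,1], [0,1,2,3,4]], Covered 1 2 0 5 (Split (Split (Split (Split (Split
     (Split (K33_sub 3 1 5 4 2 6 0) (Copy 41 [6,3,2,4,0,1,5])) (Copy 28 [4,2,6,3,0,1]))
     (Copy 38 [3,1,6,0,2])) (Split (Copy 38 [2,0,6,1,3]) (Split (Two_K2 6 4 3 2)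
     (Copy 21 [6,4,2,3,1,0])))) (Split (Split (Copy 33 [0,1,2,6,3]) (Copy 24 [1,0,6,3,2]))
     (Two_K2 6 0 2 1))) (Split (Split (Split (Copy 33 [1,0,3,6,2]) (Two_K2 6 1 3 0)) (Split
     (Copy 24 [0,1,6,2,3]) (Two_K2 6 1 3 0))) (Split (Split (Split (Copy 17 [0,2,6,1,3,4])
     (Two_K2 6 3 1 4)) (Split (Copy 21 [6,1,0,3,4,2]) (Two_K2 6 2 4 0))) (Split (Split
     (Copy 21 [6,0,1,2,4,3]) (Two_K2 6 3 1 4)) (Split (Two_K2 6 4 3 2) (Split
     (Copy 40 [6,0,4,3,2,1,5]) Isolated))))))),
   ([[], [], [1], [0,2], [0,1]], Low_degree (Split (Split (Split (Split (Copy 42 [4,2,3,0,1,5])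
     (Copy 28 [4,3,5,2,1,0])) (Copy 38 [3,1,5,0,2])) (Split (Copy 38 [2,0,5,1,3]) (Split
     (Two_K2 5 4 3 2) (Copy 21 [5,4,2,3,1,0])))) (Split (Split (Copy 33 [0,1,2,5,3])
     (Copy 24 [1,0,5,3,2])) (Two_K2 5 0 2 1)))),
   ([[], [], [1], [0,1,2], [2,3], [0,1,2,4], [1,3,5]], Low_degree (Split (K33_sub 0 6 2 1 5 3 7)
     (Split (K33_sub 0 1 4 2 5 3 7) (Two_K2 7 0 2 1)))),
   ([[], [], [0,1], [0,1], [0,2,3], [0,1,2,3]], Covered 0 2 1 3 (Split (Split
     (K33_sub 1 5 4 0 2 3 6) (Split (Split (K33 4 5 6 0 2 3) (Copy 38 [1,6,0,3,2])) (Split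
     (Copy 38 [1,6,0,2,3]) (Copy 24 [6,1,2,3,0])))) (Split (Split (Split (Split (Split
     (K33 4 5 1 2 3 6) (Copy 41 [2,6,4,5,1,0,3])) (Two_K2 6 1 4 0)) (Copy 38 [0,6,1,3,2])) (Split
     (Copy 38 [0,6,1,2,3]) (Copy 24 [6,0,2,3,1]))) (Split (Split (Split (Split (K33 0 1 6 5 2 3)
     (Two_K2 6 4 5 1)) (Split (K33 0 1 6 5 2 3) (Copy 44 [6,5,0,3,4,2,1]))) (Copy 24 [6,3,0,1,2]))
     (Split (Copy 24 [6,2,0,1,3]) (Split (Copy 24 [6,1,2,3,4]) (Split (Copy 24 [6,4,2,3,5])
     Isolated))))))),
   ([[], [], [1], [1,2], [2,3], [0,1,2,3,4], [1,3,5], [1,2,5]], Low_degree (Split (Split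
     (K33_sub 8 3 7 5 1 2 0) (Split (K33_sub 8 6 2 5 1 3 0) (Two_K2 8 0 2 3))) (Split (Split
     (K33_sub 5 3 2 8 4 1 0) (Two_K2 8 0 3 1)) (Two_K2 8 0 2 1)))),
   ([[], [], [0], [1,2], [0,1,2,3], [2,3], [0,1,2,3,4,5], [2,3,4]], Covered 2 3 4 6 (Split (Split
     (K33_sub 1 6 2 0 3 4 8) (Split (Split (K33 2 3 0 6 4 8) (Two_K2 8 0 1 3)) (Split
     (K33_sub 0 6 7 3 4 2 8) (Two_K2 8 0 1 3)))) (Split (Split (K33_sub 1 6 7 2 4 3 8)
     (Two_K2 8 1 2 0)) (Split (Split (Split (K33 7 6 8 2 4 3) (Split (Two_K2 8 5 1 4) (Split
     (K33 2 6 3 4 5 8) (Copy 29 [8,1,6,4,2,3])))) (Split (Split (K33 2 4 5 6 3 8) (Split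
     (K33 2 6 4 3 0 8) (Copy 29 [8,1,6,3,2,4]))) (Copy 33 [1,8,2,4,3]))) (Split (Split (Split
     (K33 2 6 8 4 3 5) (Split (K33 2 1 8 6 4 3) (Copy 29 [8,5,2,6,4,3]))) (Copy 33 [0,8,3,2,4]))
     (Split (Split (K33_sub 5 6 7 4 2 3 8) (Copy 33 [5,8,4,2,3])) (Split (Two_K2 8 5 1 4) (Split
     (Copy 46 [8,3,4,2,0,6,5,1]) (Split (Two_K2 8 7 6 1) Isolated))))))))),
   ([[], [], [0], [1,2], [2,3], [0,1,2,3], [0,1,2,3,4,5]], Covered 2 3 5 6 (Split (Split
     (K33_sub 1 2 5 0 3 6 7) (Split (Split (K33 3 2 0 5 6 7) (Two_K2 7 0 1 3)) (Split
     (K33_sub 0 2 1 3 5 6 7) (Two_K2 7 0 1 3)))) (Split (Split (K33_sub 1 3 0 2 5 6 7)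
     (Two_K2 7 1 2 0)) (Split (Split (Split (Split (K33 3 5 4 2 6 7) (Two_K2 7 4 1 5)) (Split (Split
     (K33 1 2 7 3 5 6) (Copy 47 [4,0,3,5,2,1,6,7])) (Split (K33 3 2 6 5 4 7)
     (Copy 29 [7,0,5,6,3,2])))) (Split (Copy 33 [7,1,3,2,4]) (Split (Split (K33 3 0 7 2 5 6)
     (Copy 29 [7,1,3,6,2,5])) (Copy 33 [1,7,2,3,5])))) (Split (Split (Copy 33 [7,0,2,3,4]) (Split
     (Split (K33 1 2 7 3 5 6) (Copy 29 [7,0,2,6,3,5])) (Copy 33 [0,7,3,2,5]))) (Split (Split
     (K33_sub 4 2 1 5 3 6 7) (Two_K2 7 4 1 5)) (Split (Copy 33 [4,7,5,3,2]) (Split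
     (Copy 46 [7,5,3,2,4,6,0,1]) Isolated)))))))),
   ([[], [], [1], [1,2], [0,1,2,3], [1,2,4], [1,3,4]], Low_degree (Split (Split
     (K33_sub 7 5 3 4 1 2 0) (Split (K33_sub 7 2 6 4 1 3 0) (Two_K2 7 0 3 2))) (Split (Split
     (Copy 33 [1,0,7,3,2]) (Two_K2 7 0 3 1)) (Two_K2 7 0 2 1)))),
   ([[], [], [1], [2], [1], [0,1,2,3,4], [0,1,2,3,4,5]], Low_degree (Split (K33_sub 0 4 2 1 6 5 7)
     (Split (K33_sub 0 1 3 2 6 5 7) (Two_K2 7 0 2 1)))),
   ([[], [], [1], [0,1], [0,1,2,3], [0,1,2,3,4]], Covered 1 3 4 5 (Split (Split
     (K33_sub 0 3 2 1 4 5 6) (Split (K33_sub 0 1 4 2 3 5 6) (Two_K2 6 0 1 2))) (Split (Split (Split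
     (K33 3 1 2 4 5 6) (Two_K2 6 2 0 3)) (Split (Split (Split (K33 0 1 6 3 4 5)
     (Copy 48 [2,6,5,3,0,1,4])) (Split (Copy 48 [2,6,4,3,0,1,5]) (Copy 29 [6,2,4,5,3,1]))) (Split
     (Split (K33 3 2 6 1 4 5) (Copy 29 [6,0,3,5,1,4])) (Copy 33 [0,6,1,3,4])))) (Split (Split
     (K33_sub 2 1 0 3 4 5 6) (Two_K2 6 2 0 3)) (Split (Split (Split (K33 0 1 6 3 4 5)
     (Copy 29 [6,2,1,5,3,4])) (Copy 33 [2,6,3,1,4])) (Split (Split (Copy 50 [6,1,3,0,2,5,4])
     (Copy 49 [6,5,1,3,4,2,0])) (Split (Copy 49 [6,4,1,3,5,2,0]) Isolated))))))),
   ([[], [], [1], [0,1], [0,1,2,3]], Low_degree (Split (Split (Split (Split (Copy 51 [2,3,0,1,5,4])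
     (Copy 45 [1,0,5,4,2,3])) (Copy 38 [3,2,5,0,1])) (Split (Copy 33 [0,2,1,5,3])
     (Copy 24 [2,0,5,3,1]))) (Split (Split (Copy 38 [1,0,5,2,3]) (Copy 43 [5,3,1,2,0]))
     (Two_K2 5 0 2 1)))),
   ([[], [], [1], [0,2]], Low_degree (Split (Split (Split (Copy 52 [0,2,1,3,4])
     (Copy 38 [3,1,4,0,2])) (Split (Copy 38 [2,0,4,1,3]) (Copy 43 [4,3,2,1,0]))) (Split (Split
     (Copy 33 [0,1,2,4,3]) (Copy 24 [1,0,4,3,2])) (Two_K2 4 0 1 2)))),
   ([[], [], [1], [0,1,2], [0,1,2,3]], Low_degree (Split (Split (K33 0 2 1 3 4 5)
     (Copy 53 [2,0,5,1])) (Split (Copy 53 [1,0,5,2]) (Two_K2 5 0 2 1)))),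
   ([[], [], [1], [0,1,2], [0,1,2]], Low_degree (Split (Split (K33 0 1 2 3 4 5) (Copy 53 [2,0,5,1]))
     (Split (Copy 53 [1,0,5,2]) (Two_K2 5 0 1 2)))),
   ([[], [], [1], [0,1,2]], Low_degree (Split (Split (Split (Copy 54 [0,1,2,4,3])
     (Copy 55 [0,2,1,4,3])) (Copy 53 [2,0,4,1])) (Split (Copy 53 [1,0,4,2]) (Two_K2 4 0 2 1)))),
   ([[], [0], [0], [0,1,2], [0,1,2,3]], Covered 0 1 2 3 (Split (Split (Split (K33 2 0 1 3 4 5)
     (Copy 56 [2,1,5,0])) (Split (Copy 56 [1,2,5,0]) (Split (Split (K33 2 1 5 0 3 4)
     (Copy 54 [5,4,2,0,3])) (Copy 56 [5,3,2,0])))) (Split (Split (Split (K33 2 1 3 0 4 5)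
     (Copy 55 [5,0,3,2,1])) (Copy 53 [2,5,1,0])) (Split (Copy 53 [1,5,2,0]) (Split
     (Copy 56 [5,0,2,3]) (Split (Copy 56 [5,0,2,4]) Isolated)))))),
   ([[], [], [0,1], [0,1], [0,1,2,3], [0,1,2,3]], Covered 0 2 1 3 (Split (Split
     (K33_sub 0 2 3 1 4 5 6) (Split (Copy 56 [1,0,6,2]) (Copy 53 [1,6,0,2]))) (Split (Split
     (Copy 56 [0,1,6,2]) (Copy 53 [0,6,1,2])) (Split (Split (K33_sub 2 0 1 3 5 4 6)
     (Copy 24 [6,3,0,1,2])) (Split (Copy 24 [6,2,0,1,3]) (Split (Copy 56 [6,0,2,4]) (Split
     (Copy 24 [6,4,2,3,5]) Isolated))))))),
   ([[], [0], [0], [0,1,2], [0,1,2]], Covered 1 0 0 2 (Split (Split (Split (K33 4 3 5 0 2 1)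
     (Copy 56 [2,1,5,0])) (Split (Copy 56 [1,2,5,0]) (Split (Split (K33 4 0 3 2 1 5)
     (Copy 18 [5,4,1,2,0,3])) (Copy 56 [5,2,3,0])))) (Split (Split (Split (Split
     (Copy 58 [4,3,5,0,1,2]) (Copy 45 [3,4,2,1,5,0])) (Copy 55 [5,0,3,2,1])) (Copy 53 [2,5,1,0]))
     (Split (Copy 53 [1,5,2,0]) (Split (Copy 56 [5,2,0,3]) (Split (Copy 24 [5,3,2,1,4])
     Isolated)))))),
   ([[], [], [0,1], [0,1,2]], Low_degree (Split (Split (Split (Copy 57 [4,0,1,3,2])
     (Copy 59 [2,0,1,3,4])) (Split (Copy 59 [3,0,1,2,4]) (Copy 55 [4,3,2,1,0]))) (Split
     (Copy 56 [1,0,4,2]) (Copy 53 [1,4,0,2])))),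
   ([[], [0], [1], [1], [0,2,3]], Low_degree (Split (Split (Copy 60 [2,0,1,5]) (Copy 56 [2,0,5,1]))
     (Split (Split (K33 1 4 5 0 3 2) (Copy 24 [3,5,0,2,1])) (Copy 53 [2,5,0,1])))),
   ([[], [], [0,1], [0,1]], Low_degree (Split (Split (Copy 60 [1,0,2,4]) (Split
     (Copy 55 [2,4,3,0,1]) (Copy 61 [4,0,3,2,1]))) (Split (Copy 56 [1,0,4,2]) (Copy 53 [1,4,0,2])))),
   ([[], [], [0,1]], Low_degree (Split (Split (Copy 60 [0,1,2,3]) (Copy 62 [3,2,1,0])) (Split
     (Copy 56 [1,0,3,2]) (Copy 53 [1,3,0,2])))),
   ([[], [0], [0,1], [0,1,2], [0,1,2,3]], Covered 0 1 2 3 (Split (Split (Split (K33 1 2 0 3 4 5)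
     (Copy 60 [2,5,0,1])) (Copy 63 [1,5,0])) (Split (Copy 63 [0,5,1]) (Split (Copy 56 [5,0,1,2])
     (Split (Copy 56 [5,2,1,3]) (Split (Copy 56 [5,3,1,4]) Isolated)))))),
   ([[], [0], [0,1], [0,1,2]], Covered 1 0 0 2 (Split (Split (Split (Split (Copy 64 [2,4,3,1,0])
     (Copy 57 [1,3,4,0,2])) (Copy 60 [2,4,0,1])) (Copy 63 [1,4,0])) (Split (Copy 63 [0,4,1]) (Split
     (Copy 56 [4,0,1,2]) (Split (Copy 56 [4,0,1,3]) Isolated))))),
   ([[], [0], [0,1]], Low_degree (Split (Split (Copy 65 [2,3,0,1]) (Copy 60 [2,3,0,1]))
     (Copy 63 [1,3,0]))),
   ([[], [0]], Low_degree (Split (Copy 66 [0,2,1]) (Copy 63 [1,2,0]))),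
   ([[]], Low_degree (Copy 67 [0,1]))
   ]"

lemma certificate_correct: "check_steps [] certificate"
  unfolding certificate_def by code_simp

section \<open>The five graphs\<close>

text \<open>The cross product of \<open>b - a\<close> and \<open>z - a\<close>, that is, twice the
  signed area of the triangle \<open>a\<close>, \<open>b\<close>, \<open>z\<close>. Its sign tells
  the side of the line through \<open>a\<close> and \<open>b\<close>, and it is affine in
  \<open>z\<close>.\<close>

definition side :: "complex \<Rightarrow> complex \<Rightarrow> complex \<Rightarrow> real" where
  "side a b z = Im ((z - a) * cnj (b - a))"

lemma side_convex: "side a b ((1 - t) *\<^sub>R c + t *\<^sub>R d) = (1 - t) * side a b c + t * side a b d"
  unfolding side_def by (simp add: algebra_simps)

lemma side_ends: "side a b a = 0" "side a b b = 0"
  unfolding side_def by (simp_all add: algebra_simps)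

lemma side_on_segment: "z \<in> closed_segment a b \<Longrightarrow> side a b z = 0"
  unfolding closed_segment_def by (auto simp: side_convex side_ends)

lemma side_same_sign:
  assumes "0 < side a b c * side a b d" "z \<in> closed_segment c d"
  shows "side a b z \<noteq> 0"
proof -
  obtain t where t: "0 \<le> t" "t \<le> 1" "z = (1 - t) *\<^sub>R c + t *\<^sub>R d"
    using assms(2) unfolding closed_segment_def by blast
  have "0 < (1 - t) * x + t * y" if "0 < x" "0 < y" for x y :: real
    using t(1,2) that by (cases "t = 0") (auto intro!: add_nonneg_pos)
  \<comment> \<open>The second instance treats the case that both values are negative.\<close>
  from this[of "side a b c" "side a b d"] this[of "- side a b c" "- side a b d"] show ?thesis
    using assms(1) unfolding t(3) side_convex zero_less_mult_iff by auto
qed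

lemma disjoint_segments:
  assumes "0 < side a b c * side a b d"
  shows "closed_segment a b \<inter> closed_segment c d = {}"
  using side_on_segment side_same_sign[OF assms] by blast

text \<open>Along the segment from \<open>a\<close> to \<open>c\<close> the function
  \<open>side a b\<close> grows linearly from 0, so it vanishes only at \<open>a\<close>.\<close>

lemma segments_common_end:
  assumes "side a b c \<noteq> 0"
  shows "closed_segment a b \<inter> closed_segment a c = {a}"
proof -
  have "z = a" if z: "z \<in> closed_segment a b" "z \<in> closed_segment a c" for z
  proof -
    obtain t where t: "z = (1 - t) *\<^sub>R a + t *\<^sub>R c"
      using z(2) unfolding closed_segment_def by blast
    have "t * side a b c = 0"
      using side_on_segment[OF z(1)] unfolding t side_convex side_ends by simp
    then show ?thesis
      using assms t by simp
  qed
  then show ?thesis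
    by auto
qed

section \<open>Straight-line drawings on integer points\<close>

definition orient :: "int \<times> int \<Rightarrow> int \<times> int \<Rightarrow> int \<times> int \<Rightarrow> int" where
  "orient a b c = (snd c - snd a) * (fst b - fst a) - (fst c - fst a) * (snd b - snd a)"

definition point :: "int \<times> int \<Rightarrow> complex" where
  "point a = Complex (of_int (fst a)) (of_int (snd a))"

lemma side_point: "side (point a) (point b) (point c) = of_int (orient a b c)"
  by (simp add: side_def point_def orient_def algebra_simps)

text \<open>No third vertex is on the line through an edge. This keeps edges off other vertices and
  lets two edges with a common end meet only there. Edges without a common end are separated by the
  line through one of them, with both ends of the other strictly on one side.\<close>

definition straight_line_check :: "(nat \<Rightarrow> int \<times> int) \<Rightarrow> nat list \<Rightarrow> (nat \<times> nat) list \<Rightarrow> bool" where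
  "straight_line_check q vs es \<longleftrightarrow> distinct (map q vs) \<and>
     (\<forall>(i, j)\<in>set es. i < j \<and> i \<in> set vs \<and> j \<in> set vs \<and>
        (\<forall>k\<in>set vs. k = i \<or> k = j \<or> orient (q i) (q j) (q k) \<noteq> 0) \<and>
        (\<forall>(k, l)\<in>set es. k = i \<or> k = j \<or> l = i \<or> l = j \<or>
           0 < orient (q i) (q j) (q k) * orient (q i) (q j) (q l) \<or>
           0 < orient (q k) (q l) (q i) * orient (q k) (q l) (q j)))"

lemma planar_straight_line:
  assumes check: "straight_line_check q vs es"
  shows "planar_graph (set vs, (\<lambda>(i, j). {i, j}) ` set es)"
proof -
  define p where "p = point \<circ> q"
  \<comment> \<open>An edge is a set, so \<open>Min\<close> and \<open>Max\<close> give its segment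
    a direction.\<close>
  define \<gamma> where "\<gamma> e = linepath (p (Min e)) (p (Max e))" for e
  have check': "i < j" "i \<in> set vs" "j \<in> set vs"
    "\<And>k. k \<in> set vs \<Longrightarrow> k \<noteq> i \<Longrightarrow> k \<noteq> j \<Longrightarrow> side (p i) (p j) (p k) \<noteq> 0"
    "\<And>k l. (k, l) \<in> set es \<Longrightarrow> {i, j} \<inter> {k, l} = {} \<Longrightarrow>
        0 < side (p i) (p j) (p k) * side (p i) (p j) (p l) \<or> 0 < side (p k) (p l) (p i) * side (p k) (p l) (p j)"
    if "(i, j) \<in> set es" for i j
    using that check unfolding straight_line_check_def p_def comp_def side_point of_int_mult[symmetric] of_int_0_less_iff by fastforce+
  have "inj_on q (set vs)"
    using check by (simp add: straight_line_check_def distinct_map)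
  then have inj: "inj_on p (set vs)"
    unfolding p_def by (auto simp: inj_on_def point_def prod_eq_iff)
  have \<gamma>: "\<gamma> {i, j} = linepath (p i) (p j)" if "i < j" for i j
    using that unfolding \<gamma>_def by (simp add: max_def min_def)
  have "planar_drawing (set vs, (\<lambda>(i, j). {i, j}) ` set es) p \<gamma>"
    unfolding planar_drawing_def fst_conv snd_conv ball_simps(9)
  proof (intro conjI ballI impI)
    show "inj_on p (set vs)"
      by (rule inj)
  next
    fix ij assume ij: "ij \<in> set es"
    obtain i j where [simp]: "ij = (i, j)"
      by fastforce
    note c = check'[OF ij[simplified]]
    have "p i \<noteq> p j"
      using c(1-3) inj by (auto simp: inj_on_eq_iff)
    then show "arc (\<gamma> (case ij of (i, j) \<Rightarrow> {i, j}))"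
      using c(1) by (simp add: \<gamma> arc_linepath)
    show "{pathstart (\<gamma> (case ij of (i, j) \<Rightarrow> {i, j})), pathfinish (\<gamma> (case ij of (i, j) \<Rightarrow> {i, j}))} =
      p ` (case ij of (i, j) \<Rightarrow> {i, j})"
      using c(1) by (simp add: \<gamma>)
    have "k = i \<or> k = j" if "k \<in> set vs" "p k \<in> closed_segment (p i) (p j)" for k
      using c(4)[OF that(1)] side_on_segment[OF that(2)] by blast
    then show "path_image (\<gamma> (case ij of (i, j) \<Rightarrow> {i, j})) \<inter> p ` set vs = p ` (case ij of (i, j) \<Rightarrow> {i, j})"
      using c(1-3) by (auto simp: \<gamma>)
  next
    fix ij kl assume ij: "ij \<in> set es" and kl: "kl \<in> set es"
      and "(case ij of (i, j) \<Rightarrow> {i, j}) \<noteq> (case kl of (i, j) \<Rightarrow> {i, j})"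
    moreover obtain i j k l where [simp]: "ij = (i, j)" "kl = (k, l)"
      by fastforce
    ultimately have neq: "{i, j} \<noteq> {k, l}"
      by simp
    note c = check'[OF ij[simplified]] and d = check'[OF kl[simplified]]
    have "closed_segment (p i) (p j) \<inter> closed_segment (p k) (p l) = p ` ({i, j} \<inter> {k, l})"
    proof (cases "{i, j} \<inter> {k, l} = {}")
      case True
      then have "closed_segment (p i) (p j) \<inter> closed_segment (p k) (p l) = {}"
        using c(5)[OF kl[simplified]] disjoint_segments by (metis Int_commute)
      then show ?thesis
        using True by simp
    next
      case False
      then obtain a b b' where ab: "{i, j} = {a, b}" "{k, l} = {a, b'}"
        by (auto simp: insert_commute)
      then have seg: "closed_segment (p i) (p j) = closed_segment (p a) (p b)"
        "closed_segment (p k) (p l) = closed_segment (p a) (p b')"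
        by (auto simp: doubleton_eq_iff closed_segment_commute)
      have "b \<noteq> b'" "b' \<noteq> a" "b' \<in> set vs"
        using ab neq d(1-3) by (auto simp: doubleton_eq_iff)
      \<comment> \<open>The edges share \<open>a\<close>; the other end \<open>b'\<close> of the
        second is off the line through the first.\<close>
      then have "side (p i) (p j) (p b') \<noteq> 0"
        using c(4)[of b'] ab(1) by blast
      then have "side (p a) (p b) (p b') \<noteq> 0"
        using ab(1) by (auto simp: doubleton_eq_iff side_def algebra_simps)
      then show ?thesis
        unfolding seg ab using segments_common_end \<open>b \<noteq> b'\<close> by (simp add: Int_insert_left)
    qed
    then show "path_image (\<gamma> (case ij of (i, j) \<Rightarrow> {i, j})) \<inter> path_image (\<gamma> (case kl of (i, j) \<Rightarrow> {i, j})) =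
      p ` ((case ij of (i, j) \<Rightarrow> {i, j}) \<inter> (case kl of (i, j) \<Rightarrow> {i, j}))"
      using c(1) d(1) by (simp add: \<gamma>)
  qed
  then show ?thesis
    unfolding planar_graph_def by blast
qed

text \<open>Position 0 of the lists is unused, since the vertices are numbered from 1.\<close>

definition Tc_points :: "nat \<Rightarrow> nat \<Rightarrow> int \<times> int" where
  "Tc_points k = (!) ((0, 0) #
     (if k < 4 then [(5,0), (1,0), (2,1), (4,2), (3,5), (3,1), (2,2)]
      else [(5,2), (3,2), (2,1), (0,4), (2,3), (0,0), (1,3)]))"

text \<open>The first four graphs are subgraphs of \<open>Tc43\<close>, so one set of points draws
  them all; the pentagonal bipyramid has its own drawing.\<close>

lemma Tc_straight_line: "\<forall>k\<in>set [0..<5]. straight_line_check (Tc_points k) [1..<8] (Tc_pairs ! k)"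
  by code_simp

lemma Tc_vertices: "{1, 2, 3, 4, 5, 6, 7 :: nat} = set [1..<8]"
  by auto

lemma Tc_planar:
  assumes "k < 5"
  shows "planar_graph (Tc_graphs ! k)"
proof -
  have "straight_line_check (Tc_points k) [1..<8] (Tc_pairs ! k)"
    using assms by (intro bspec[OF Tc_straight_line]) simp
  then show ?thesis
    unfolding Tc_graphs_nth[OF assms] Tc_vertices by (rule planar_straight_line)
qed

section \<open>The five graphs are simple and connected\<close>

lemma Tc_simple:
  assumes "k < 5"
  shows "simple_graph (Tc_graphs ! k)"
proof -
  have "\<forall>ps\<in>set Tc_pairs. \<forall>(i, j)\<in>set ps. i \<in> {1, 2, 3, 4, 5, 6, 7} \<and> j \<in> {1, 2, 3, 4, 5, 6, 7}"
    "length Tc_pairs = 5"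
    by (simp_all add: Tc_pairs_def Let_def)
  then have "i \<in> {1, 2, 3, 4, 5, 6, 7} \<and> j \<in> {1, 2, 3, 4, 5, 6, 7} \<and> i \<noteq> j"
    if "(i, j) \<in> set (Tc_pairs ! k)" for i j
    using that Tc_pairs_ordered[OF assms that] assms nth_mem[of k Tc_pairs] by fastforce
  then show ?thesis
    unfolding simple_graph_def Tc_graphs_nth[OF assms] by (auto simp: card_insert_if)
qed

lemma Tc_connected:
  assumes "k < 5"
  shows "connected_graph (Tc_graphs ! k)"
proof -
  define R where "R = {(x, y). {x, y} \<in> edges (Tc_graphs ! k)}"
  \<comment> \<open>These pairs form a spanning tree common to all five graphs; every vertex is
    reached in it from vertex 1.\<close>
  have "\<forall>ps\<in>set Tc_pairs. {(1,2), (1,3), (1,4), (2,5), (2,7), (3,6)} \<subseteq> set ps" "length Tc_pairs = 5"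
    by (simp_all add: Tc_pairs_def Let_def)
  then have "{(1,2), (1,3), (1,4), (2,5), (2,7), (3,6)} \<subseteq> set (Tc_pairs ! k)"
    using assms nth_mem[of k Tc_pairs] by simp
  then have R: "(1,2) \<in> R" "(1,3) \<in> R" "(1,4) \<in> R" "(2,5) \<in> R" "(2,7) \<in> R" "(3,6) \<in> R"
    using Tc_edge_iff[OF assms] by (auto simp: R_def)
  then have star: "(1,1) \<in> R\<^sup>*" "(1,2) \<in> R\<^sup>*" "(1,3) \<in> R\<^sup>*" "(1,4) \<in> R\<^sup>*" "(1,5) \<in> R\<^sup>*" "(1,6) \<in> R\<^sup>*"
    "(1,7) \<in> R\<^sup>*"
    by (blast intro: converse_rtrancl_into_rtrancl)+
  then have from1: "(1, v) \<in> R\<^sup>*" if "v \<in> verts (Tc_graphs ! k)" for v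
    using that unfolding Tc_graphs_nth[OF assms] fst_conv by (elim insertE emptyE) (simp_all only:)
  moreover have "sym (R\<^sup>*)"
    by (intro sym_rtrancl) (auto simp: R_def sym_def insert_commute)
  ultimately have "(u, v) \<in> R\<^sup>*" if "u \<in> verts (Tc_graphs ! k)" "v \<in> verts (Tc_graphs ! k)" for u v
    using that by (meson rtrancl_trans symD)
  moreover have "verts (Tc_graphs ! k) \<noteq> {}"
    unfolding Tc_graphs_nth[OF assms] by simp
  ultimately show ?thesis
    unfolding connected_graph_def R_def by blast
qed

section \<open>The five graphs are 2-line e.c\<close>

definition meets :: "nat \<times> nat \<Rightarrow> nat \<times> nat \<Rightarrow> bool" where
  "meets e f \<longleftrightarrow> fst e = fst f \<or> fst e = snd f \<or> snd e = fst f \<or> snd e = snd f"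

text \<open>As \<open>e\<close> and \<open>f\<close> run over ordered pairs, the middle condition
  covers both ways of putting one edge into \<open>A\<close> and the other into \<open>B\<close>.
  Since \<open>meets\<close> is reflexive, an edge that fails to meet \<open>e\<close> also differs
  from it.\<close>

definition ec_check :: "(nat \<times> nat) list \<Rightarrow> bool" where
  "ec_check es \<longleftrightarrow> (\<forall>e\<in>set es. \<forall>f\<in>set es. e = f \<or>
     (\<exists>g\<in>set es. g \<noteq> e \<and> g \<noteq> f \<and> meets g e \<and> meets g f) \<and>
     (\<exists>g\<in>set es. g \<noteq> e \<and> meets g e \<and> \<not> meets g f) \<and>
     (\<exists>g\<in>set es. \<not> meets g e \<and> \<not> meets g f))"

lemma two_line_ec_check:
  assumes ordered: "\<And>i j. (i, j) \<in> set es \<Longrightarrow> i < j" and two: "2 \<le> card (set es)" and check: "ec_check es"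
  shows "two_line_ec (V, (\<lambda>(i, j). {i, j}) ` set es)"
proof -
  define E where "E = (\<lambda>(i, j). {i, j :: nat})"
  have inj: "E e = E f \<longleftrightarrow> e = f" if "e \<in> set es" "f \<in> set es" for e f
    using that ordered[of "fst e" "snd e"] ordered[of "fst f" "snd f"] unfolding E_def
    by (auto simp: doubleton_eq_iff case_prod_beta prod_eq_iff)
  have meets: "E e \<inter> E f \<noteq> {} \<longleftrightarrow> meets e f" for e f
    unfolding E_def meets_def by (auto simp: case_prod_beta)
  have refl: "meets e e" for e
    by (simp add: meets_def)
  have adjacent: "adjacent_edges (E e) (E f) \<longleftrightarrow> e \<noteq> f \<and> meets e f" if "e \<in> set es" "f \<in> set es" for e f
    using that inj meets unfolding adjacent_edges_def by metis
  have "\<exists>g\<in>E ` set es. g \<notin> A \<union> B \<and> (\<forall>a\<in>A. adjacent_edges g a) \<and> (\<forall>b\<in>B. \<not> adjacent_edges g b)"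
    if AB: "A \<subseteq> E ` set es" "B \<subseteq> E ` set es" "A \<inter> B = {}" "card (A \<union> B) = 2" for A B
  proof -
    obtain e f where ef: "e \<in> set es" "f \<in> set es" "e \<noteq> f" "A \<union> B = {E e, E f}"
    proof -
      obtain x y where xy: "A \<union> B = {x, y}" "x \<noteq> y"
        using AB(4) unfolding card_2_iff by blast
      then have "{x, y} \<subseteq> E ` set es"
        using AB(1,2) by (metis Un_least)
      then obtain e f where "e \<in> set es" "f \<in> set es" "x = E e" "y = E f"
        by auto
      then show ?thesis
        using that xy by metis
    qed
    \<comment> \<open>\<open>P\<close> and \<open>Q\<close> say whether \<open>e\<close> and
      \<open>f\<close> are to be met. They are then taken to be membership in \<open>A\<close>,
      which determines \<open>B\<close> because \<open>A\<close> and \<open>B\<close> partition the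
      two edges.\<close>
    have g: "\<exists>g\<in>set es. g \<noteq> e \<and> g \<noteq> f \<and> (P \<longleftrightarrow> meets g e) \<and> (Q \<longleftrightarrow> meets g f)" for P Q
    proof -
      have both: "\<exists>g\<in>set es. g \<noteq> e \<and> g \<noteq> f \<and> meets g e \<and> meets g f"
        and first: "\<exists>g\<in>set es. g \<noteq> e \<and> meets g e \<and> \<not> meets g f"
        and none: "\<exists>g\<in>set es. \<not> meets g e \<and> \<not> meets g f"
        using bspec[OF bspec[OF check[unfolded ec_check_def] ef(1)] ef(2)] ef(3) by simp_all
      have second: "\<exists>g\<in>set es. g \<noteq> f \<and> meets g f \<and> \<not> meets g e"
        using bspec[OF bspec[OF check[unfolded ec_check_def] ef(2)] ef(1)] ef(3) by simp
      show ?thesis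
        using both first second none refl by (cases P; cases Q) (simp_all only: simp_thms, metis+)
    qed
    obtain g where g: "g \<in> set es" "g \<noteq> e" "g \<noteq> f" "E e \<in> A \<longleftrightarrow> meets g e" "E f \<in> A \<longleftrightarrow> meets g f"
      using g by blast
    have "E g \<notin> A \<union> B"
      unfolding ef(4) using g(1-3) ef(1,2) inj by auto
    moreover have "adjacent_edges (E g) a \<longleftrightarrow> a \<in> A" if "a \<in> A \<union> B" for a
      using that g adjacent[OF g(1) ef(1)] adjacent[OF g(1) ef(2)] unfolding ef(4) by auto
    ultimately show ?thesis
      using g(1) AB(3) by blast
  qed
  moreover have "card (E ` set es) = card (set es)"
    using inj by (intro card_image inj_onI) auto
  ultimately show ?thesis
    using two unfolding two_line_ec_def E_def by simp
qed

lemma Tc_ec_check: "\<forall>k\<in>set [0..<5]. ec_check (Tc_pairs ! k) \<and> 2 \<le> length (remdups (Tc_pairs ! k))"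
  by code_simp

lemma Tc_ec:
  assumes "k < 5"
  shows "two_line_ec (Tc_graphs ! k)"
proof -
  have "ec_check (Tc_pairs ! k) \<and> 2 \<le> length (remdups (Tc_pairs ! k))"
    using assms by (intro bspec[OF Tc_ec_check]) simp
  then show ?thesis
    unfolding Tc_graphs_nth[OF assms] using Tc_pairs_ordered[OF assms]
    by (intro two_line_ec_check) (simp_all add: length_remdups_card_conv)
qed

section \<open>Degree counts as isomorphism invariants\<close>

definition degree_count :: "'a ugraph \<Rightarrow> nat \<Rightarrow> nat" where
  "degree_count G d = card {v \<in> verts G. card {u \<in> verts G. {v, u} \<in> edges G} = d}"

lemma degree_count_iso:
  assumes "graph_iso G H"
  shows "degree_count G d = degree_count H d"
proof -
  obtain f where f: "bij_betw f (verts G) (verts H)"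
    "\<And>u v. u \<in> verts G \<Longrightarrow> v \<in> verts G \<Longrightarrow> {u, v} \<in> edges G \<longleftrightarrow> {f u, f v} \<in> edges H"
    using assms unfolding graph_iso_def by blast
  have bij: "bij_betw f {v \<in> verts G. P v} {v \<in> verts H. Q v}"
    if "\<And>v. v \<in> verts G \<Longrightarrow> P v \<longleftrightarrow> Q (f v)" for P Q
  proof -
    have "inj_on f (verts G)" "verts H = f ` verts G"
      using f(1) unfolding bij_betw_def by auto
    then show ?thesis
      using that unfolding bij_betw_def by (auto simp: inj_on_def)
  qed
  have "card {u \<in> verts G. {v, u} \<in> edges G} = card {u \<in> verts H. {f v, u} \<in> edges H}" if "v \<in> verts G" for v
    using f(2)[OF that] by (intro bij_betw_same_card[OF bij]) auto
  then show ?thesis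
    unfolding degree_count_def by (intro bij_betw_same_card[OF bij]) auto
qed

lemma card_Collect_upt: "card {v \<in> set [a..<b]. P v} = length (filter P [a..<b])"
  by (metis distinct_card distinct_filter distinct_upt set_filter)

lemma degree_count_Tc:
  assumes "k < 5"
  shows "degree_count (Tc_graphs ! k) d = length (filter (\<lambda>v. length (filter (\<lambda>u.
     (v, u) \<in> set (Tc_pairs ! k) \<or> (u, v) \<in> set (Tc_pairs ! k)) [1..<8]) = d) [1..<8])"
proof -
  have "{v, u} \<in> edges (Tc_graphs ! k) \<longleftrightarrow> (v, u) \<in> set (Tc_pairs ! k) \<or> (u, v) \<in> set (Tc_pairs ! k)" for u v
    unfolding Tc_graphs_nth[OF assms] by (auto simp: image_iff doubleton_eq_iff split: prod.splits)
  moreover have "verts (Tc_graphs ! k) = set [1..<8]"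
    unfolding Tc_graphs_nth[OF assms] Tc_vertices by simp
  ultimately show ?thesis
    unfolding degree_count_def by (simp only: card_Collect_upt)
qed

text \<open>The number of vertices of degree 3 separates all pairs except \<open>Tc39\<close> and
  \<open>Tc43\<close>; these differ in the number of vertices of degree 4.\<close>

lemma Tc_degree_counts:
  "map (\<lambda>k. map (\<lambda>d. length (filter (\<lambda>v. length (filter (\<lambda>u.
     (v, u) \<in> set (Tc_pairs ! k) \<or> (u, v) \<in> set (Tc_pairs ! k)) [1..<8]) = d) [1..<8])) [3, 4]) [0..<5] =
   [[4, 3], [2, 5], [1, 5], [1, 3], [0, 5]]"
  by code_simp

lemma Tc_not_iso:
  assumes "i < 5" "j < 5" "i \<noteq> j"
  shows "\<not> graph_iso (Tc_graphs ! i) (Tc_graphs ! j)"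
proof
  assume iso: "graph_iso (Tc_graphs ! i) (Tc_graphs ! j)"
  define c where "c k = map (degree_count (Tc_graphs ! k)) [3, 4]" for k
  have "map c [0..<5] = [[4, 3], [2, 5], [1, 5], [1, 3], [0, 5]]"
    unfolding Tc_degree_counts[symmetric] by (rule map_cong) (simp_all add: c_def degree_count_Tc)
  then have "distinct (map c [0..<5])"
    by simp
  then have "inj_on c {0..<5}"
    by (simp add: distinct_map)
  moreover have "c i = c j"
    unfolding c_def using degree_count_iso[OF iso] by simp
  ultimately show False
    using assms by (simp add: inj_on_def)
qed

theorem mainTheorem2:
  shows "(\<forall>i<5. simple_graph (Tc_graphs ! i) \<and> connected_graph (Tc_graphs ! i) \<and>
            planar_graph (Tc_graphs ! i) \<and> two_line_ec (Tc_graphs ! i)) \<and>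
         (\<forall>i<5. \<forall>j<5. i \<noteq> j \<longrightarrow> \<not> graph_iso (Tc_graphs ! i) (Tc_graphs ! j)) \<and>
         (\<forall>G :: 'a ugraph.
            simple_graph G \<and> connected_graph G \<and> planar_graph G \<and> two_line_ec G \<longrightarrow>
            (\<exists>i<5. graph_iso G (Tc_graphs ! i)))"
proof (intro conjI allI impI)
  fix G :: "'a ugraph"
  assume "simple_graph G \<and> connected_graph G \<and> planar_graph G \<and> two_line_ec G"
  then interpret planar_two_line_ec G
    by unfold_locales auto
  show "\<exists>i<5. graph_iso G (Tc_graphs ! i)"
    using check_steps_sound[OF _ certificate_correct] by simp
qed (simp_all add: Tc_simple Tc_connected Tc_planar Tc_ec Tc_not_iso)

end
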